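(* Let $X$ be a quasi-Banach rearrangement invariant space on $\mathbb R^n$ satisfying: (i) $\varphi_{X'}(t)\le C\,\dfrac{t}{\varphi_X(t)}$ for all $t>0$; (ii) there exists $0<\delta<1$ such that $M_\delta:X\to M^\infty(X)$ is bounded, where $$\|f\|_{M^\infty(X)}=\sup_{t>0}t\,\varphi_X(\lambda_f(t))=\sup_{s>0}\varphi_X(s)f^*(s);$$ (iii) there exists $0<\mu<1$ such that, for all $s>0$, $$\Big\|\frac1{(1+\frac{\cdot}{s})^\mu}\Big\|_{\overline{X'}}\le C\,\varphi_{X'}(s).$$ Let $1\le p_0<\infty$ and let $(f,g)$ be a pair of positive measurable functions on $\mathbb R^n$ such that, for every $w\in A_{p_0}$, $$\|g\|_{L^{p_0,\infty}(w)}\le \varphi(\|w\|_{A_{p_0}})\,\|f\|_{L^{p_0}(w)},$$ where $\varphi$ is a locally bounded function. Then $$\|g\|_{M^\infty(X)}\le C'\|f\|_X,$$ with $C'$ independent of $f$ and $g$.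
   Context: $M$ is the Hardy–Littlewood maximal operator $Mf(x)=\sup_{x\in Q}\frac1{|Q|}\int_Q|f|$ (supremum over cubes containing $x$), and for $0<\mu<1$, $M_\mu f=\big(M(|f|^{1/\mu})\big)^\mu$. $\lambda_f(t)=|\{|f|>t\}|$ and $f^*$ is the decreasing rearrangement with respect to Lebesgue measure. $\bar X$ is the representation space of $X$ on $(0,\infty)$, so $\|f\|_X=\|f^*\|_{\bar X}$; $\varphi_X(t)=\|\chi_E\|_X$, $|E|=t$, is the fundamental function. $X'$ is the associate space, $\|f\|_{X'}=\sup_{\|g\|_X\le1}\left|\int_{\mathbb R^n}fg\,dx\right|$, $\overline{X'}$ is its representation space on $(0,\infty)$ and $\varphi_{X'}$ its fundamental function. $\|g\|_{L^{p,\infty}(w)}=\sup_{y>0}y\,w(\{|g|>y\})^{1/p}$. $A_p$ is the Muckenhoupt class with $\|w\|_{A_p}=\sup_Q\big(\frac1{|Q|}\int_Qw\big)\big(\frac1{|Q|}\int_Qw^{-1/(p-1)}\big)^{p-1}$ for $1<p<\infty$ and $\|w\|_{A_1}=\sup_Q\big(\frac1{|Q|}\int_Qw\big)\|w^{-1}\|_{L^\infty(Q)}$. A function $\varphi$ on $(0,\infty)$ is locally bounded if $\sup_{0<t<K}\varphi(t)<\infty$ for every $K>0$. *)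

theory Defs
  imports "HOL-Analysis.Analysis" "HOL-Probability.Essential_Supremum"
begin

text \<open>Real powers on $[0,\infty]$; only positive exponents are used, so the value at infinity
  is infinity.\<close>

definition epowr :: "ennreal \<Rightarrow> real \<Rightarrow> ennreal" (infixr "epowr" 80) where
  "x epowr a = (if x = \<infinity> then \<infinity> else ennreal (enn2real x powr a))"

abbreviation eabs :: "('a \<Rightarrow> real) \<Rightarrow> 'a \<Rightarrow> ennreal" where
  "eabs f \<equiv> (\<lambda>x. ennreal \<bar>f x\<bar>)"

subsection \<open>Cubes and maximal operators\<close>

definition cubes :: "(real^'n) set set" where
  "cubes = {cbox a (a + vec r) |a r. 0 < r}"

definition avg :: "(real^'n) set \<Rightarrow> (real^'n \<Rightarrow> ennreal) \<Rightarrow> ennreal" where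
  "avg Q f = (\<integral>\<^sup>+x\<in>Q. f x \<partial>lebesgue) / emeasure lebesgue Q"

definition maximal :: "(real^'n \<Rightarrow> real) \<Rightarrow> real^'n \<Rightarrow> ennreal" where
  "maximal f x = (SUP Q\<in>{Q\<in>cubes. x \<in> Q}. avg Q (eabs f))"

definition maximal_pow :: "real \<Rightarrow> (real^'n \<Rightarrow> real) \<Rightarrow> real^'n \<Rightarrow> ennreal" where
  "maximal_pow \<mu> f x = maximal (\<lambda>y. \<bar>f y\<bar> powr (1 / \<mu>)) x epowr \<mu>"

subsection \<open>Distribution function and decreasing rearrangement\<close>

text \<open>Both are defined for functions with values in $[0,\infty]$, since maximal functions may be
  infinite; they are applied to a real function \<open>f\<close> as \<open>eabs f\<close>.\<close>

definition distr_fun :: "'a measure \<Rightarrow> ('a \<Rightarrow> ennreal) \<Rightarrow> ennreal \<Rightarrow> ennreal" where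
  "distr_fun M f t = emeasure M {x\<in>space M. t < f x}"

definition rearr :: "'a measure \<Rightarrow> ('a \<Rightarrow> ennreal) \<Rightarrow> real \<Rightarrow> ennreal" where
  "rearr M f s = Inf {t. distr_fun M f t \<le> ennreal s}"

subsection \<open>Quasi-Banach rearrangement invariant spaces\<close>

text \<open>A space is given by its quasi-norm \<open>X\<close>, a functional on the measurable functions with value
  infinity exactly outside the space. The Fatou property is not required.\<close>

definition quasi_banach_ri :: "((real^'n \<Rightarrow> real) \<Rightarrow> ennreal) \<Rightarrow> bool" where
  "quasi_banach_ri X \<longleftrightarrow>
    (\<forall>f\<in>borel_measurable lebesgue. X f = 0 \<longleftrightarrow> (AE x in lebesgue. f x = 0)) \<and>
    (\<forall>f\<in>borel_measurable lebesgue. \<forall>c. X (\<lambda>x. c * f x) = ennreal \<bar>c\<bar> * X f) \<and>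
    (\<exists>K::real. \<forall>f\<in>borel_measurable lebesgue. \<forall>g\<in>borel_measurable lebesgue.
       X (\<lambda>x. f x + g x) \<le> ennreal K * (X f + X g)) \<and>
    (\<forall>f\<in>borel_measurable lebesgue. \<forall>g\<in>borel_measurable lebesgue.
       (AE x in lebesgue. \<bar>f x\<bar> \<le> \<bar>g x\<bar>) \<longrightarrow> X f \<le> X g) \<and>
    (\<forall>E\<in>sets lebesgue. emeasure lebesgue E < \<infinity> \<longrightarrow> X (indicat_real E) < \<infinity>) \<and>
    (\<forall>f\<in>borel_measurable lebesgue. \<forall>g\<in>borel_measurable lebesgue.
       distr_fun lebesgue (eabs f) = distr_fun lebesgue (eabs g) \<longrightarrow> X f = X g) \<and>
    (\<forall>u::nat \<Rightarrow> real^'n \<Rightarrow> real.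
       (\<forall>k. u k \<in> borel_measurable lebesgue \<and> X (u k) < \<infinity>) \<and>
       (\<forall>e>0. \<exists>N. \<forall>i\<ge>N. \<forall>j\<ge>N. X (\<lambda>x. u i x - u j x) < e) \<longrightarrow>
       (\<exists>v\<in>borel_measurable lebesgue. X v < \<infinity> \<and> (\<lambda>k. X (\<lambda>x. u k x - v x)) \<longlonglongrightarrow> 0))"

text \<open>Representation space on $(0,\infty)$: the norm of \<open>h\<close> is the norm of any function on
  $\mathbb{R}^n$ equimeasurable with \<open>h\<close>. The infimum is over a set with at most one element if
  \<open>X\<close> is rearrangement invariant; see \<open>rep_norm_rearr\<close> below for the defining identity.\<close>

definition rep_norm :: "((real^'n \<Rightarrow> real) \<Rightarrow> ennreal) \<Rightarrow> (real \<Rightarrow> ennreal) \<Rightarrow> ennreal" where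
  "rep_norm X h = Inf {X f |f. f \<in> borel_measurable lebesgue \<and>
     distr_fun lebesgue (eabs f) = distr_fun (lebesgue_on {0<..}) h}"

text \<open>Likewise, for rearrangement invariant \<open>X\<close> the norm below does not depend on \<open>E\<close>.\<close>

definition fundamental :: "((real^'n \<Rightarrow> real) \<Rightarrow> ennreal) \<Rightarrow> real \<Rightarrow> ennreal" where
  "fundamental X t = (INF E\<in>{E\<in>sets lebesgue. emeasure lebesgue E = ennreal t}. X (indicat_real E))"

definition associate :: "((real^'n \<Rightarrow> real) \<Rightarrow> ennreal) \<Rightarrow> (real^'n \<Rightarrow> real) \<Rightarrow> ennreal" where
  "associate X f =
    (SUP g\<in>{g\<in>borel_measurable lebesgue. X g \<le> 1 \<and> integrable lebesgue (\<lambda>x. f x * g x)}.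
       ennreal \<bar>LINT x|lebesgue. f x * g x\<bar>)"

text \<open>For \<open>X\<close> with the Fatou property this equals the supremum over \<open>t > 0\<close> of \<open>t\<close> times the
  fundamental function at \<open>distr_fun lebesgue f t\<close>; without it the two agree up to
  twice the constant of the quasi-triangle inequality. The form used here needs no convention for the
  fundamental function at infinity.\<close>

definition Minf_norm :: "((real^'n \<Rightarrow> real) \<Rightarrow> ennreal) \<Rightarrow> (real^'n \<Rightarrow> ennreal) \<Rightarrow> ennreal" where
  "Minf_norm X f = (SUP s\<in>{0<..}. fundamental X s * rearr lebesgue f s)"

subsection \<open>Weights\<close>

definition weight :: "(real^'n \<Rightarrow> real) \<Rightarrow> bool" where
  "weight w \<longleftrightarrow> w \<in> borel_measurable lebesgue \<and> (AE x in lebesgue. 0 < w x) \<and>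
     (\<forall>Q\<in>cubes. (\<integral>\<^sup>+x\<in>Q. ennreal (w x) \<partial>lebesgue) < \<infinity>)"

text \<open>Reciprocals are taken in $[0,\infty]$, so that a zero of \<open>w\<close> does not get the value
  \<open>1 / 0 = 0\<close> of the reals.\<close>

definition Ap_const :: "real \<Rightarrow> (real^'n \<Rightarrow> real) \<Rightarrow> ennreal" where
  "Ap_const p w =
    (if p = 1
     then SUP Q\<in>cubes. avg Q (\<lambda>x. ennreal (w x)) *
            esssup (lebesgue_on Q) (\<lambda>x. inverse (ennreal (w x)))
     else SUP Q\<in>cubes. avg Q (\<lambda>x. ennreal (w x)) *
            avg Q (\<lambda>x. inverse (ennreal (w x)) epowr (1 / (p - 1))) epowr (p - 1))"

definition Ap_class :: "real \<Rightarrow> (real^'n \<Rightarrow> real) set" where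
  "Ap_class p = {w. weight w \<and> Ap_const p w < \<infinity>}"

definition Lp_norm :: "real \<Rightarrow> (real^'n \<Rightarrow> real) \<Rightarrow> (real^'n \<Rightarrow> real) \<Rightarrow> ennreal" where
  "Lp_norm p w f = (\<integral>\<^sup>+x. ennreal (\<bar>f x\<bar> powr p) * ennreal (w x) \<partial>lebesgue) epowr (1 / p)"

definition weak_Lp_norm :: "real \<Rightarrow> (real^'n \<Rightarrow> real) \<Rightarrow> (real^'n \<Rightarrow> real) \<Rightarrow> ennreal" where
  "weak_Lp_norm p w g =
    (SUP y\<in>{0<..}. ennreal y * (\<integral>\<^sup>+x\<in>{x. y < \<bar>g x\<bar>}. ennreal (w x) \<partial>lebesgue) epowr (1 / p))"

definition locally_bounded :: "(real \<Rightarrow> real) \<Rightarrow> bool" where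
  "locally_bounded \<phi> \<longleftrightarrow> (\<forall>K>0. bdd_above (\<phi> ` {0<..<K}))"

subsection \<open>The representation identity\<close>

lemma distr_fun_antimono:
  assumes "f \<in> borel_measurable M" "t \<le> u"
  shows "distr_fun M f u \<le> distr_fun M f t"
  unfolding distr_fun_def using assms by (intro emeasure_mono) auto

lemma less_rearr_iff:
  assumes f: "f \<in> borel_measurable M"
  shows "t < rearr M f s \<longleftrightarrow> ennreal s < distr_fun M f t"
proof
  assume "t < rearr M f s"
  then have "t \<notin> {t. distr_fun M f t \<le> ennreal s}"
    unfolding rearr_def by (meson Inf_lower leD)
  then show "ennreal s < distr_fun M f t" by auto
next
  assume s: "ennreal s < distr_fun M f t"
  have "t \<noteq> \<infinity>" using s by (auto simp: distr_fun_def)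
  define u where "u n = t + ennreal (1 / real (Suc n))" for n :: nat
  have tu: "t < u n" for n
    using \<open>t \<noteq> \<infinity>\<close> by (cases t) (auto simp: u_def ennreal_less_iff simp flip: ennreal_plus)
  have "(\<lambda>n. ennreal (1 / real (Suc n))) \<longlonglongrightarrow> ennreal 0"
    by (intro tendsto_ennrealI) (use LIMSEQ_inverse_real_of_nat in \<open>simp add: inverse_eq_divide\<close>)
  then have "u \<longlonglongrightarrow> t + 0"
    unfolding u_def by (intro tendsto_add) auto
  then have lim: "u \<longlonglongrightarrow> t" by simp
  have dec: "u n \<le> u m" if "m \<le> n" for m n
    unfolding u_def using that by (intro add_left_mono ennreal_leI) (simp add: frac_le)
  have "{x\<in>space M. t < f x} = (\<Union>n. {x\<in>space M. u n < f x})"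
  proof (intro equalityI subsetI)
    fix x assume "x \<in> {x\<in>space M. t < f x}"
    moreover from this lim have "eventually (\<lambda>n. u n < f x) sequentially"
      by (auto intro: order_tendstoD)
    then obtain n where "u n < f x" by (auto simp: eventually_sequentially)
    ultimately show "x \<in> (\<Union>n. {x\<in>space M. u n < f x})" by auto
  qed (use tu in \<open>auto intro: less_trans\<close>)
  moreover have "(SUP n. emeasure M {x\<in>space M. u n < f x})
      = emeasure M (\<Union>n. {x\<in>space M. u n < f x})"
  proof (rule SUP_emeasure_incseq)
    show "range (\<lambda>n. {x\<in>space M. u n < f x}) \<subseteq> sets M" using f by auto
    show "incseq (\<lambda>n. {x\<in>space M. u n < f x})"
      using dec by (auto simp: incseq_def intro: le_less_trans)
  qed
  ultimately have "distr_fun M f t = (SUP n. distr_fun M f (u n))"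
    by (simp add: distr_fun_def)
  with s obtain n where n: "ennreal s < distr_fun M f (u n)"
    by (auto simp: less_SUP_iff)
  have "u n \<le> rearr M f s"
    unfolding rearr_def
  proof (rule Inf_greatest)
    fix v assume "v \<in> {t. distr_fun M f t \<le> ennreal s}"
    with n have "distr_fun M f v < distr_fun M f (u n)" by auto
    with distr_fun_antimono[OF f, of v "u n"] show "u n \<le> v"
      by (meson leD linear)
  qed
  with tu[of n] show "t < rearr M f s" by (rule less_le_trans)
qed

lemma distr_fun_rearr:
  assumes f: "f \<in> borel_measurable M"
  shows "distr_fun (lebesgue_on {0<..}) (rearr M f) = distr_fun M f"
proof
  fix t
  have "{s\<in>space (lebesgue_on {0<..}). t < rearr M f s} = {s\<in>{0<..}. ennreal s < distr_fun M f t}"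
    using f by (auto simp: less_rearr_iff)
  then have "distr_fun (lebesgue_on {0<..}) (rearr M f) t
      = emeasure (lebesgue_on {0<..}) {s\<in>{0<..}. ennreal s < distr_fun M f t}"
    by (simp add: distr_fun_def)
  also have "\<dots> = emeasure lebesgue {s\<in>{0<..}. ennreal s < distr_fun M f t}"
    by (intro emeasure_restrict_space) auto
  also have "\<dots> = distr_fun M f t"
  proof (cases "distr_fun M f t")
    case (real r)
    then have "{s\<in>{0<..}. ennreal s < distr_fun M f t} = {0<..<r}"
      by (auto simp: ennreal_less_iff)
    with real show ?thesis by simp
  next
    case top
    then have "{s\<in>{0<..}. ennreal s < distr_fun M f t} = {0::real<..}" by auto
    moreover have "emeasure lebesgue {0::real<..} = \<infinity>"
    proof (rule ccontr)
      assume "emeasure lebesgue {0::real<..} \<noteq> \<infinity>"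
      then obtain r where r: "0 \<le> r" "emeasure lebesgue {0::real<..} = ennreal r"
        by (cases "emeasure lebesgue {0::real<..}") auto
      have "emeasure lebesgue {0<..<r + 1} \<le> emeasure lebesgue {0::real<..}"
        by (intro emeasure_mono) auto
      with r show False by simp
    qed
    ultimately show ?thesis using top by simp
  qed
  finally show "distr_fun (lebesgue_on {0<..}) (rearr M f) t = distr_fun M f t" .
qed

lemma rep_norm_rearr:
  assumes X: "quasi_banach_ri X" and f: "f \<in> borel_measurable lebesgue"
  shows "rep_norm X (rearr lebesgue (eabs f)) = X f"
proof -
  have ri: "X g = X f" if "g \<in> borel_measurable lebesgue"
    "distr_fun lebesgue (eabs g) = distr_fun lebesgue (eabs f)" for g
    using X f that unfolding quasi_banach_ri_def by blast
  have m: "eabs f \<in> borel_measurable lebesgue" using f by measurable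
  have "{X g |g. g \<in> borel_measurable lebesgue \<and>
      distr_fun lebesgue (eabs g) = distr_fun lebesgue (eabs f)} = {X f}"
    using f by (blast intro: ri)
  then show ?thesis by (simp add: rep_norm_def distr_fun_rearr[OF m])
qed

end

(* Let F be a set of finite measure on which g > y and M_delta f <= y. By the theorem of Coifman and
   Rochberg and the easy half of the factorization theorem, w = (M chi_F)^mu (M_delta f)^(1 - p0) is
   an A_{p0} weight with constant independent of f and F. The weak type hypothesis for w gives
   y |F| <= C int f (M chi_F)^mu, because w >= y^(1 - p0) on F and f <= M_delta f. The rearrangement of
   (M chi_F)^mu decays like (1 + t/|F|)^(-mu), so (iii), (i) and duality bound the right-hand side by
   C X(f) |F| / phi_X(|F|), that is y phi_X(|F|) <= C X(f). The rest of {g > y} lies in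
   {M_delta f > y}, which is controlled by (ii). *)

theory Submission
  imports Defs
begin

section \<open>The maximal operator\<close>

text \<open>The exponent mu has two tasks: mu < 1 turns M chi_F into an A_1 weight, and the same mu
  is the decay rate of the profile in (iii). The delicate point is duality.
  \<open>associate X\<close> is a supremum over test functions with integrable product, and (iii)
  speaks of a model profile, not of (M chi_F)^mu itself. Hence one function h on the whole space
  with that profile is fixed, f is truncated and rearranged along the level sets of h, and (M
  chi_F)^mu is compared with h through distribution functions alone. Nestedness of the level sets
  turns this comparison into an inequality of integrals. A level set of g of measure above s is cut
  in two; one piece exceeds s/2, and the quasi-triangle inequality leads back to s at the price of a
  constant. If f = 0 almost everywhere, then M_delta f vanishes and the weight degenerates, so that
  case is settled with a fixed weight.\<close>

lemma lebesgue_Collect: "Measurable.pred lebesgue P \<Longrightarrow> Collect P \<in> sets lebesgue"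
  by (simp add: pred_def)

lemma emeasure_cube:
  fixes a :: "real^'n"
  assumes "0 \<le> r"
  shows "emeasure lborel (cbox a (a + vec r)) = ennreal (r ^ CARD('n))"
proof -
  have ne: "cbox a (a + vec r) \<noteq> {}"
    using assms by (auto simp: interval_ne_empty_cart)
  have "emeasure lborel (cbox a (a + vec r)) = ennreal (measure lborel (cbox a (a + vec r)))"
    using emeasure_lborel_cbox_finite[of a "a + vec r"] by (intro emeasure_eq_ennreal_measure) auto
  also have "measure lborel (cbox a (a + vec r)) = r ^ CARD('n)"
    using content_cbox_cart[OF ne] by simp
  finally show ?thesis .
qed

lemma cubesE:
  assumes "Q \<in> cubes"
  obtains a r where "Q = cbox a (a + vec r)" "0 < r"
  using assms by (auto simp: cubes_def)

lemma cube_sets[measurable_dest]: "Q \<in> cubes \<Longrightarrow> Q \<in> sets lebesgue"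
  by (auto simp: cubes_def)

lemma emeasure_cubeE:
  fixes Q :: "(real^'n) set"
  assumes "Q \<in> cubes"
  obtains q where "0 < q" "emeasure lebesgue Q = ennreal q"
proof -
  from assms obtain a :: "real^'n" and r where "Q = cbox a (a + vec r)" "0 < r"
    by (rule cubesE)
  with that[of "r ^ CARD('n)"] show ?thesis by (simp add: emeasure_cube)
qed

lemma avg_mult_emeasure:
  assumes "Q \<in> cubes"
  shows "avg Q f * emeasure lebesgue Q = (\<integral>\<^sup>+x\<in>Q. f x \<partial>lebesgue)"
proof -
  obtain q where "0 < q" "emeasure lebesgue Q = ennreal q"
    using assms by (rule emeasure_cubeE)
  then show ?thesis
    unfolding avg_def by (simp add: ennreal_divide_times)
qed

lemma avg_le_iff:
  assumes "Q \<in> cubes"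
  shows "avg Q f \<le> c \<longleftrightarrow> (\<integral>\<^sup>+x\<in>Q. f x \<partial>lebesgue) \<le> c * emeasure lebesgue Q"
proof -
  obtain q where "0 < q" "emeasure lebesgue Q = ennreal q"
    using assms by (rule emeasure_cubeE)
  then show ?thesis
    using ennreal_mult_le_mult_iff[of "emeasure lebesgue Q" "avg Q f" c]
    by (simp add: mult.commute flip: avg_mult_emeasure[OF assms])
qed

section \<open>Lower semicontinuity of the maximal function\<close>

lemma less_maximalE:
  fixes x :: "real^'n"
  assumes "t < maximal h x"
  obtains a r where "0 < r" "x \<in> cbox a (a + vec r)"
    "t * ennreal (r ^ CARD('n)) < (\<integral>\<^sup>+y\<in>cbox a (a + vec r). eabs h y \<partial>lebesgue)"
proof -
  from assms obtain Q where Q: "Q \<in> cubes" "x \<in> Q" "t < avg Q (eabs h)"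
    by (auto simp: maximal_def less_SUP_iff)
  obtain a r where r: "Q = cbox a (a + vec r)" "0 < r" using Q(1) by (rule cubesE)
  with Q avg_le_iff[OF Q(1), of "eabs h" t] that[of r a] show ?thesis
    by (simp add: emeasure_cube not_le[symmetric])
qed

lemma avg_le_maximal: "Q \<in> cubes \<Longrightarrow> x \<in> Q \<Longrightarrow> avg Q (eabs h) \<le> maximal h x"
  unfolding maximal_def by (intro SUP_upper) auto

lemma integral_le_maximal:
  assumes "Q \<in> cubes" "x \<in> Q"
  shows "(\<integral>\<^sup>+y\<in>Q. eabs h y \<partial>lebesgue) \<le> maximal h x * emeasure lebesgue Q"
  using avg_le_maximal[OF assms, of h] by (simp only: avg_le_iff[OF assms(1)])

text \<open>A witness cube may contain the point only on its boundary, so it is enlarged a little on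
  every side. Volume depends continuously on the side length, hence the average over a slight
  enlargement still exceeds \<open>t\<close>, and the open interior of the enlargement is the
  required neighbourhood.\<close>

lemma open_maximal:
  fixes h :: "real^'n \<Rightarrow> real"
  shows "open {x. t < maximal h x}"
proof (subst open_subopen, rule ballI)
  fix x assume "x \<in> {x. t < maximal h x}"
  then have tx: "t < maximal h x" by simp
  then obtain a r where ar: "0 < r" "x \<in> cbox a (a + vec r)"
    "t * ennreal (r ^ CARD('n)) < (\<integral>\<^sup>+y\<in>cbox a (a + vec r). eabs h y \<partial>lebesgue)" (is "_ < ?I")
    by (rule less_maximalE)
  define u where "u n = r + 2 * inverse (real (Suc n))" for n
  have "u \<longlonglongrightarrow> r + 2 * 0"
    unfolding u_def by (intro tendsto_intros LIMSEQ_inverse_real_of_nat)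
  \<comment> \<open>Multiplication by \<open>t\<close> is continuous because
    \<open>t < maximal h x\<close> makes \<open>t\<close> finite.\<close>
  then have "(\<lambda>n. t * ennreal (u n ^ CARD('n))) \<longlonglongrightarrow> t * ennreal (r ^ CARD('n))"
    using ar(1) tx order_less_le_trans[OF tx top_greatest] by (intro ennreal_tendsto_cmult tendsto_ennrealI tendsto_power) auto
  then have "eventually (\<lambda>n. t * ennreal (u n ^ CARD('n)) < ?I) sequentially"
    using ar(3) by (rule order_tendstoD)
  then obtain n where n: "t * ennreal (u n ^ CARD('n)) < ?I"
    by (auto simp: eventually_sequentially)
  define e where "e = inverse (real (Suc n))"
  have e: "0 < e" by (simp add: e_def)
  define b where "b = a - vec e"
  let ?Q = "cbox b (b + vec (u n))"
  have un: "0 < u n" using ar(1) by (simp add: u_def add_pos_pos)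
  have Q: "?Q \<in> cubes" unfolding cubes_def using un by blast
  have sub: "cbox a (a + vec r) \<subseteq> box b (b + vec (u n))"
  proof
    fix y assume "y \<in> cbox a (a + vec r)"
    then have "a $ i \<le> y $ i \<and> y $ i \<le> a $ i + r" for i by (auto simp: mem_box_cart)
    then have "a $ i - e < y $ i \<and> y $ i < a $ i - e + (r + 2 * e)" for i
      using e by (smt (verit))
    then show "y \<in> box b (b + vec (u n))"
      by (simp add: mem_box_cart b_def u_def e_def)
  qed
  have "?I \<le> (\<integral>\<^sup>+y\<in>?Q. eabs h y \<partial>lebesgue)"
    using sub box_subset_cbox by (intro nn_integral_mono) (auto split: split_indicator)
  with n have "t * emeasure lebesgue ?Q < (\<integral>\<^sup>+y\<in>?Q. eabs h y \<partial>lebesgue)"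
    using un by (simp add: emeasure_cube)
  then have *: "t < avg ?Q (eabs h)"
    using avg_le_iff[OF Q, of "eabs h" t] by (simp add: not_le[symmetric])
  have "box b (b + vec (u n)) \<subseteq> {x. t < maximal h x}"
    using avg_le_maximal[OF Q] * box_subset_cbox by (blast intro: less_le_trans)
  moreover have "x \<in> box b (b + vec (u n))" using sub ar(2) by auto
  ultimately show "\<exists>T. open T \<and> x \<in> T \<and> T \<subseteq> {x. t < maximal h x}"
    using open_box by blast
qed

lemma borel_measurable_maximal[measurable]: "maximal h \<in> borel_measurable lebesgue"
proof -
  have "maximal h \<in> borel_measurable borel"
    by (rule borel_measurableI_greater) (simp add: borel_open open_maximal)
  then have "maximal h \<in> borel_measurable lborel" by simp
  then show ?thesis by (rule measurable_completion)
qed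

lemma sets_maximal_gt[measurable]: "{x. t < maximal h x} \<in> sets lebesgue"
  using open_maximal[of t h] by auto

section \<open>The weak type (1,1) inequality\<close>

lemma emeasure_UN_le_nn_integral:
  assumes [measurable]: "\<And>i. i \<in> I \<Longrightarrow> A i \<in> sets M" and I: "countable I"
  shows "emeasure M (\<Union>i\<in>I. A i) \<le> (\<integral>\<^sup>+i. emeasure M (A i) \<partial>count_space I)"
proof -
  have [measurable]: "(\<Union>i\<in>I. A i) \<in> sets M" using I by (intro sets.countable_UN') auto
  have "emeasure M (\<Union>i\<in>I. A i) = (\<integral>\<^sup>+x. indicator (\<Union>i\<in>I. A i) x \<partial>M)" by simp
  also have "\<dots> \<le> (\<integral>\<^sup>+x. (\<integral>\<^sup>+i. indicator (A i) x \<partial>count_space I) \<partial>M)"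
  proof (intro nn_integral_mono)
    fix x
    show "indicator (\<Union>i\<in>I. A i) x \<le> (\<integral>\<^sup>+i. indicator (A i) x \<partial>count_space I :: ennreal)"
    proof (cases "x \<in> (\<Union>i\<in>I. A i)")
      case True
      then obtain j where j: "j \<in> I" "x \<in> A j" by auto
      have "(1::ennreal) = (\<integral>\<^sup>+i. indicator {j} i \<partial>count_space I)"
        using j by (subst nn_integral_indicator) auto
      also have "\<dots> \<le> (\<integral>\<^sup>+i. indicator (A i) x \<partial>count_space I)"
        using j by (intro nn_integral_mono) (auto split: split_indicator)
      finally show ?thesis using True by simp
    qed simp
  qed
  also have "\<dots> = (\<integral>\<^sup>+i. (\<integral>\<^sup>+x. indicator (A i) x \<partial>M) \<partial>count_space I)"
    using I by (intro nn_integral_count_space_nn_integral) auto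
  also have "\<dots> = (\<integral>\<^sup>+i. emeasure M (A i) \<partial>count_space I)"
    by (intro nn_integral_cong) auto
  finally show ?thesis .
qed

text \<open>The integral of \<open>h\<close> over a set is the measure of that set under
  \<open>density M h\<close>, so subadditivity of measures applies.\<close>

lemma nn_integral_UN_le:
  assumes h: "h \<in> borel_measurable M" and A: "\<And>i. i \<in> I \<Longrightarrow> A i \<in> sets M" and I: "countable I"
  shows "(\<integral>\<^sup>+x\<in>(\<Union>i\<in>I. A i). h x \<partial>M) \<le> (\<integral>\<^sup>+i. (\<integral>\<^sup>+x\<in>A i. h x \<partial>M) \<partial>count_space I)"
proof -
  have "(\<Union>i\<in>I. A i) \<in> sets M" using I A by (intro sets.countable_UN') auto
  then have "(\<integral>\<^sup>+x\<in>(\<Union>i\<in>I. A i). h x \<partial>M) = emeasure (density M h) (\<Union>i\<in>I. A i)"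
    using h by (simp add: emeasure_density)
  also have "\<dots> \<le> (\<integral>\<^sup>+i. emeasure (density M h) (A i) \<partial>count_space I)"
    using A I by (intro emeasure_UN_le_nn_integral) auto
  also have "\<dots> = (\<integral>\<^sup>+i. (\<integral>\<^sup>+x\<in>A i. h x \<partial>M) \<partial>count_space I)"
    using h A by (intro nn_integral_cong) (auto simp: emeasure_density)
  finally show ?thesis .
qed

lemma nn_integral_UN_disjoint:
  assumes h: "h \<in> borel_measurable M" and A: "\<And>i. i \<in> I \<Longrightarrow> A i \<in> sets M" and I: "countable I"
    and d: "disjoint_family_on A I"
  shows "(\<integral>\<^sup>+x\<in>(\<Union>i\<in>I. A i). h x \<partial>M) = (\<integral>\<^sup>+i. (\<integral>\<^sup>+x\<in>A i. h x \<partial>M) \<partial>count_space I)"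
proof -
  have "(\<Union>i\<in>I. A i) \<in> sets M" using I A by (intro sets.countable_UN') auto
  then have "(\<integral>\<^sup>+x\<in>(\<Union>i\<in>I. A i). h x \<partial>M) = emeasure (density M h) (\<Union>i\<in>I. A i)"
    using h by (simp add: emeasure_density)
  also have "\<dots> = (\<integral>\<^sup>+i. emeasure (density M h) (A i) \<partial>count_space I)"
    using A I d by (intro emeasure_UN_countable) auto
  also have "\<dots> = (\<integral>\<^sup>+i. (\<integral>\<^sup>+x\<in>A i. h x \<partial>M) \<partial>count_space I)"
    using h A by (intro nn_integral_cong) (auto simp: emeasure_density)
  finally show ?thesis .
qed

text \<open>Vitali's lemma is about balls, the maximal operator about cubes. The factor
  \<open>CARD('n)\<close> comes from estimating the Euclidean norm by the sum of the
  coordinates.\<close>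

lemma cube_subset_cball:
  fixes a :: "real^'n"
  assumes "0 \<le> r"
  shows "cbox a (a + vec r) \<subseteq> cball a (real CARD('n) * r)"
proof
  fix y assume "y \<in> cbox a (a + vec r)"
  then have y: "\<bar>(y - a) $ i\<bar> \<le> r" for i by (auto simp: mem_box_cart) (smt (verit))
  have "norm (y - a) \<le> (\<Sum>i\<in>UNIV. \<bar>(y - a) $ i\<bar>)" by (rule norm_le_l1_cart)
  also have "\<dots> \<le> real CARD('n) * r" using sum_bounded_above[of UNIV "\<lambda>i. \<bar>(y - a) $ i\<bar>" r] y by simp
  finally show "y \<in> cball a (real CARD('n) * r)" by (simp add: dist_norm norm_minus_commute)
qed

lemma cball_subset_cube:
  fixes a :: "real^'n"
  shows "cball a r \<subseteq> cbox (a - vec r) ((a - vec r) + vec (2 * r))"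
proof
  fix y assume "y \<in> cball a r"
  then have "norm (y - a) \<le> r" by (simp add: dist_norm norm_minus_commute)
  then have "\<bar>(y - a) $ i\<bar> \<le> r" for i using component_le_norm_cart[of "y - a" i] by linarith
  then show "y \<in> cbox (a - vec r) ((a - vec r) + vec (2 * r))"
    by (auto simp: mem_box_cart abs_le_iff) (smt (verit))+
qed

text \<open>Every point of the level set has a cube over which the integral of
  \<open>\<bar>h\<bar>\<close> exceeds \<open>t\<close> times the volume. Each cube sits in a ball;
  disjoint balls are selected so that their fivefold dilations cover. A ball of radius
  \<open>5 * CARD('n) * r\<close> fits into a cube of side \<open>10 * CARD('n) * r\<close>, whence
  the constant.\<close>

lemma weak_type_maximal:
  fixes h :: "real^'n \<Rightarrow> real"
  assumes [measurable]: "h \<in> borel_measurable lebesgue" and t: "0 < t"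
  shows "ennreal t * emeasure lebesgue {x. ennreal t < maximal h x}
    \<le> ennreal ((10 * real CARD('n)) ^ CARD('n)) * (\<integral>\<^sup>+x. eabs h x \<partial>lebesgue)"
proof (cases "(\<integral>\<^sup>+x. eabs h x \<partial>lebesgue) = \<infinity>")
  case True
  then show ?thesis by (simp add: ennreal_mult_top)
next
  case False
  let ?d = "CARD('n)"
  let ?S = "{x. ennreal t < maximal h x}"
  obtain I where I: "0 \<le> I" "(\<integral>\<^sup>+x. eabs h x \<partial>lebesgue) = ennreal I"
    using False by (cases "\<integral>\<^sup>+x. eabs h x \<partial>lebesgue") auto
  define P where "P x a r \<longleftrightarrow> (0 < r \<and> x \<in> cbox a (a + vec r) \<and>
    ennreal t * ennreal (r ^ ?d) < (\<integral>\<^sup>+y\<in>cbox a (a + vec r). eabs h y \<partial>lebesgue))" for x a r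
  have "\<forall>x\<in>?S. \<exists>z. P x (fst z) (snd z)"
  proof
    fix x assume "x \<in> ?S"
    then obtain a r where "P x a r"
      unfolding P_def using less_maximalE[of "ennreal t" h x] by blast
    then show "\<exists>z. P x (fst z) (snd z)" by (intro exI[of _ "(a, r)"]) simp
  qed
  from bchoice[OF this] obtain z where z: "\<forall>x\<in>?S. P x (fst (z x)) (snd (z x))" ..
  define a where "a x = fst (z x)" for x
  define r where "r x = snd (z x)" for x
  have ar: "0 < r x" "x \<in> cbox (a x) (a x + vec (r x))"
    "ennreal t * ennreal (r x ^ ?d) < (\<integral>\<^sup>+y\<in>cbox (a x) (a x + vec (r x)). eabs h y \<partial>lebesgue)"
    if "x \<in> ?S" for x
    using bspec[OF z that] by (simp_all add: P_def a_def r_def)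
  define Q where "Q x = cbox (a x) (a x + vec (r x))" for x
  \<comment> \<open>The covering lemma asks for bounded radii. If \<open>r x > 1\<close> then
    \<open>r x \<le> r x ^ ?d\<close>, and \<open>t * r x ^ ?d < I\<close>.\<close>
  have rb: "r x \<le> max 1 (I / t)" if "x \<in> ?S" for x
  proof (cases "r x \<le> 1")
    case False
    have "(\<integral>\<^sup>+y\<in>Q x. eabs h y \<partial>lebesgue) \<le> (\<integral>\<^sup>+y. eabs h y \<partial>lebesgue)"
      by (intro nn_integral_mono) (auto split: split_indicator)
    with ar(3)[OF that] have "ennreal t * ennreal (r x ^ ?d) < ennreal I"
      unfolding Q_def I(2) by (rule less_le_trans)
    then have "t * r x ^ ?d < I"
      using t ar(1)[OF that] I by (simp add: ennreal_less_iff flip: ennreal_mult)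
    moreover have "r x \<le> r x ^ ?d"
      using False self_le_power[of "r x" ?d] by (simp add: Suc_leI)
    ultimately have "t * r x \<le> I" using t by (smt (verit) mult_left_mono)
    then have "r x \<le> I / t" using t by (simp add: field_simps)
    then show ?thesis by linarith
  qed auto
  define R where "R x = real ?d * r x" for x
  have QR: "Q x \<subseteq> cball (a x) (R x)" if "x \<in> ?S" for x
    using cube_subset_cball[of "r x" "a x"] ar(1)[OF that] by (simp add: Q_def R_def)
  have xQ: "x \<in> Q x" if "x \<in> ?S" for x using ar(2)[OF that] by (simp add: Q_def)
  have cov: "?S \<subseteq> (\<Union>x\<in>?S. cball (a x) (R x))" using QR xQ by blast
  have Rb: "0 < R x \<and> R x \<le> real ?d * max 1 (I / t)" if "x \<in> ?S" for x
    using ar(1)[OF that] rb[OF that] by (simp add: R_def)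
  obtain C where C: "countable C" "C \<subseteq> ?S"
    "pairwise (\<lambda>i j. disjnt (cball (a i) (R i)) (cball (a j) (R j))) C"
    "?S \<subseteq> (\<Union>i\<in>C. cball (a i) (5 * R i))"
    by (rule Vitali_covering_lemma_cballs[OF cov Rb])
  have disj: "disjoint_family_on Q C"
    unfolding disjoint_family_on_def
  proof (intro ballI impI)
    fix i j assume ij: "i \<in> C" "j \<in> C" "i \<noteq> j"
    then have "disjnt (cball (a i) (R i)) (cball (a j) (R j))"
      using C(3) by (auto simp: pairwise_def)
    then show "Q i \<inter> Q j = {}" using QR ij C(2) unfolding disjnt_def by blast
  qed
  have big: "ennreal t * emeasure lebesgue (cball (a i) (5 * R i))
      \<le> ennreal ((10 * real ?d) ^ ?d) * (\<integral>\<^sup>+y\<in>Q i. eabs h y \<partial>lebesgue)" if "i \<in> C" for i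
  proof -
    have iS: "i \<in> ?S" using that C(2) by blast
    have r: "0 < r i" using ar(1)[OF iS] by simp
    have "emeasure lebesgue (cball (a i) (5 * R i))
        \<le> emeasure lebesgue (cbox (a i - vec (5 * R i)) (a i - vec (5 * R i) + vec (2 * (5 * R i))))"
      by (rule emeasure_mono[OF cball_subset_cube]) auto
    also have "\<dots> = ennreal ((2 * (5 * R i)) ^ ?d)"
      using emeasure_cube[of "2 * (5 * R i)"] r by (simp add: R_def)
    also have "(2 * (5 * R i)) ^ ?d = (10 * real ?d) ^ ?d * r i ^ ?d"
      by (simp add: R_def power_mult_distrib)
    finally have "ennreal t * emeasure lebesgue (cball (a i) (5 * R i))
        \<le> ennreal t * ennreal ((10 * real ?d) ^ ?d * r i ^ ?d)"
      by (rule mult_left_mono) simp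
    also have "\<dots> = ennreal ((10 * real ?d) ^ ?d) * (ennreal t * ennreal (r i ^ ?d))"
      using r t by (simp add: ennreal_mult mult_ac)
    also have "\<dots> \<le> ennreal ((10 * real ?d) ^ ?d) * (\<integral>\<^sup>+y\<in>Q i. eabs h y \<partial>lebesgue)"
      using ar(3)[OF iS] unfolding Q_def by (intro mult_left_mono less_imp_le) auto
    finally show ?thesis .
  qed
  have "emeasure lebesgue ?S \<le> emeasure lebesgue (\<Union>i\<in>C. cball (a i) (5 * R i))"
    using C by (intro emeasure_mono sets.countable_UN') auto
  also have "\<dots> \<le> (\<integral>\<^sup>+i. emeasure lebesgue (cball (a i) (5 * R i)) \<partial>count_space C)"
    using C by (intro emeasure_UN_le_nn_integral) auto
  finally have "ennreal t * emeasure lebesgue ?S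
      \<le> ennreal t * (\<integral>\<^sup>+i. emeasure lebesgue (cball (a i) (5 * R i)) \<partial>count_space C)"
    by (rule mult_left_mono) simp
  also have "\<dots> = (\<integral>\<^sup>+i. ennreal t * emeasure lebesgue (cball (a i) (5 * R i)) \<partial>count_space C)"
    by (simp add: nn_integral_cmult)
  also have "\<dots> \<le> (\<integral>\<^sup>+i. ennreal ((10 * real ?d) ^ ?d) * (\<integral>\<^sup>+y\<in>Q i. eabs h y \<partial>lebesgue) \<partial>count_space C)"
    using big by (intro nn_integral_mono) auto
  also have "\<dots> = ennreal ((10 * real ?d) ^ ?d) * (\<integral>\<^sup>+y\<in>(\<Union>i\<in>C. Q i). eabs h y \<partial>lebesgue)"
    using C disj by (subst nn_integral_UN_disjoint) (auto simp: nn_integral_cmult Q_def)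
  also have "\<dots> \<le> ennreal ((10 * real ?d) ^ ?d) * (\<integral>\<^sup>+y. eabs h y \<partial>lebesgue)"
    by (intro mult_left_mono nn_integral_mono) (auto split: split_indicator)
  finally show ?thesis .
qed

text \<open>Non-overlapping dyadic cubes that meet the set \<open>S\<close> below and lie in an open \<open>T \<supseteq> S\<close> of
  almost the same measure give \<open>b |S| \<le> \<integral> |h| \<le> a |T|\<close>; no differentiation theorem is needed.\<close>

lemma emeasure_small_maximal_eq_0:
  fixes h :: "real^'n \<Rightarrow> real"
  assumes [measurable]: "h \<in> borel_measurable lebesgue" and ab: "0 \<le> a" "a < b" and k: "0 < k"
  shows "emeasure lebesgue {x \<in> cbox (- vec k) (vec k). maximal h x \<le> ennreal a \<and> b \<le> \<bar>h x\<bar>} = 0"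
    (is "emeasure lebesgue ?S = 0")
proof (rule ccontr)
  assume "emeasure lebesgue ?S \<noteq> 0"
  have [measurable]: "cbox (- vec k) (vec k :: real^'n) \<in> sets lebesgue" by simp
  have S[measurable]: "?S \<in> sets lebesgue" by measurable
  have "emeasure lebesgue ?S \<le> emeasure lebesgue (cbox (- vec k) (vec k :: real^'n))"
    by (intro emeasure_mono) auto
  also have "\<dots> < \<infinity>" using emeasure_lborel_cbox_finite[of "- vec k" "vec k :: real^'n"] by simp
  finally have "emeasure lebesgue ?S < \<infinity>" .
  then obtain m where m: "0 \<le> m" "emeasure lebesgue ?S = ennreal m"
    by (cases "emeasure lebesgue ?S") auto
  with \<open>emeasure lebesgue ?S \<noteq> 0\<close> have m0: "0 < m" by (cases "m = 0") auto
  \<comment> \<open>Chosen to make \<open>a * (m + e) < b * m\<close>, which the covering will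
    contradict; the denominator is \<open>a + 1\<close> because \<open>a\<close> may be
    zero.\<close>
  define e where "e = (b - a) * m / (a + 1)"
  have e: "0 < e" using ab m0 by (simp add: e_def)
  have "a * e < (b - a) * m"
  proof -
    have "a * e = (a / (a + 1)) * ((b - a) * m)" by (simp add: e_def)
    also have "\<dots> < 1 * ((b - a) * m)"
      using ab m0 by (intro mult_strict_right_mono) auto
    finally show ?thesis by simp
  qed
  then have ae: "a * (m + e) < b * m" by (simp add: algebra_simps)
  obtain T where T: "open T" "?S \<subseteq> T" "T - ?S \<in> lmeasurable" "emeasure lebesgue (T - ?S) < ennreal e"
    using sets_lebesgue_outer_open[OF S e] .
  have Tm[measurable]: "T \<in> sets lebesgue" using T(1) by auto
  have "emeasure lebesgue T = emeasure lebesgue (?S \<union> (T - ?S))"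
    using T(2) by (simp add: Un_absorb1)
  also have "\<dots> \<le> emeasure lebesgue ?S + emeasure lebesgue (T - ?S)"
    by (intro emeasure_subadditive) auto
  also have "\<dots> \<le> ennreal m + ennreal e" using m T(4) by (intro add_mono) auto
  also have "\<dots> = ennreal (m + e)" using m e by simp
  finally have Te: "emeasure lebesgue T \<le> ennreal (m + e)" .
  \<comment> \<open>A gauge that confines every selected cube, tagged by a point of the set, to
    \<open>T\<close>.\<close>
  define g where "g x = (if x \<in> ?S then T else UNIV)" for x
  have gg: "gauge g" using T by (auto simp: gauge_def g_def)
  have ne: "box (- vec k) (vec k :: real^'n) \<noteq> {}"
    using k by (auto simp: interval_ne_empty_cart)
  have Sc: "?S \<subseteq> cbox (- vec k) (vec k)" by auto
  obtain D where D: "countable D" "\<Union>D \<subseteq> cbox (- vec k) (vec k)"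
    "\<And>K. K \<in> D \<Longrightarrow> interior K \<noteq> {} \<and> (\<exists>c d. K = cbox c d)"
    "pairwise (\<lambda>A B. interior A \<inter> interior B = {}) D"
    "\<And>K. K \<in> D \<Longrightarrow> \<exists>x \<in> ?S \<inter> K. K \<subseteq> g x"
    "\<And>u v. cbox u v \<in> D \<Longrightarrow> \<exists>n. \<forall>i \<in> Basis. v \<bullet> i - u \<bullet> i = (vec k \<bullet> i - (- vec k) \<bullet> i) / 2^n"
    "?S \<subseteq> \<Union>D"
    by (rule covering_lemma[OF Sc ne gg]) (rule that; assumption)
  have K: "K \<in> cubes \<and> emeasure lebesgue (interior K) = emeasure lebesgue K
      \<and> (\<integral>\<^sup>+x\<in>K. eabs h x \<partial>lebesgue) \<le> ennreal a * emeasure lebesgue K \<and> K \<subseteq> T" if KD: "K \<in> D" for K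
  proof -
    obtain u v where uv: "K = cbox u v" using D(3)[OF KD] by blast
    obtain n :: nat where n: "\<forall>i\<in>Basis. v \<bullet> i - u \<bullet> i = (vec k \<bullet> i - (- vec k) \<bullet> i) / 2^n"
      using D(6) KD uv by blast
    \<comment> \<open>The initial box is a cube, so its dyadic pieces have the same side in each
      coordinate and belong to \<open>cubes\<close>.\<close>
    have vu: "v $ i - u $ i = 2 * k / 2 ^ n" for i
      using n[rule_format, of "axis i 1"] by (simp add: axis_in_Basis_iff inner_axis inner_axis')
    then have "v = u + vec (2 * k / 2 ^ n)"
      by (simp add: vec_eq_iff) (metis add.commute diff_add_cancel)
    then have cube: "K \<in> cubes" unfolding cubes_def uv using k by (auto intro!: exI[of _ "2 * k / 2 ^ n"])
    obtain x where x: "x \<in> ?S" "x \<in> K" "K \<subseteq> g x" using D(5)[OF KD] by blast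
    have "(\<integral>\<^sup>+x\<in>K. eabs h x \<partial>lebesgue) \<le> maximal h x * emeasure lebesgue K"
      using integral_le_maximal[OF cube x(2)] .
    also have "\<dots> \<le> ennreal a * emeasure lebesgue K" using x(1) by (intro mult_right_mono) auto
    finally show ?thesis
      using x cube uv by (simp add: g_def interior_cbox emeasure_lborel_box_eq emeasure_lborel_cbox_eq)
  qed
  have "ennreal (b * m) = (\<integral>\<^sup>+x\<in>?S. ennreal b \<partial>lebesgue)"
    using m ab by (simp add: ennreal_mult nn_integral_cmult_indicator del: mem_Collect_eq)
  also have "\<dots> \<le> (\<integral>\<^sup>+x\<in>(\<Union>K\<in>D. K). eabs h x \<partial>lebesgue)"
    using D(7) by (intro nn_integral_mono) (auto split: split_indicator intro!: ennreal_leI)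
  \<comment> \<open>The closed cubes may share faces, so the integral is estimated by subadditivity;
    the measures are summed over the interiors, which are disjoint and lose no measure.\<close>
  also have "\<dots> \<le> (\<integral>\<^sup>+K. (\<integral>\<^sup>+x\<in>K. eabs h x \<partial>lebesgue) \<partial>count_space D)"
    using K D(1) by (intro nn_integral_UN_le) (auto intro: cube_sets)
  also have "\<dots> \<le> (\<integral>\<^sup>+K. ennreal a * emeasure lebesgue (interior K) \<partial>count_space D)"
    using K by (intro nn_integral_mono) auto
  also have "\<dots> = ennreal a * (\<integral>\<^sup>+K. emeasure lebesgue (interior K) \<partial>count_space D)"
    by (simp add: nn_integral_cmult)
  also have "(\<integral>\<^sup>+K. emeasure lebesgue (interior K) \<partial>count_space D) = emeasure lebesgue (\<Union>K\<in>D. interior K)"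
    using D(1,4) by (intro emeasure_UN_countable[symmetric])
      (auto simp: disjoint_family_on_def pairwise_def)
  also have "ennreal a * \<dots> \<le> ennreal a * emeasure lebesgue T"
    using K interior_subset by (intro mult_left_mono emeasure_mono) fastforce+
  also have "\<dots> \<le> ennreal a * ennreal (m + e)" using Te by (intro mult_left_mono) auto
  also have "\<dots> = ennreal (a * (m + e))" using ab m e by (simp add: ennreal_mult)
  finally have "b * m \<le> a * (m + e)" using ab m e by (simp add: ennreal_le_iff)
  with ae show False by simp
qed

text \<open>If the inequality fails at a point, two rationals fit strictly between
  \<open>maximal h x\<close> and \<open>\<bar>h x\<bar>\<close>, and the point lies in some large
  box. The exceptional set is thus covered by countably many of the null sets just treated.\<close>

lemma AE_le_maximal:
  fixes h :: "real^'n \<Rightarrow> real"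
  assumes [measurable]: "h \<in> borel_measurable lebesgue"
  shows "AE x in lebesgue. eabs h x \<le> maximal h x"
proof -
  define S where "S a b k = {x \<in> cbox (- vec k) (vec k). maximal h x \<le> ennreal a \<and> b \<le> \<bar>h x\<bar>}"
    for a b k
  have "AE x in lebesgue. \<forall>a\<in>\<rat>. \<forall>b\<in>\<rat>. \<forall>n::nat. 0 \<le> a \<and> a < b \<longrightarrow> x \<notin> S a b (real (Suc n))"
  proof (intro AE_ball_countable' AE_all_countable[THEN iffD2] allI countable_rat)
    fix a b :: real and n :: nat
    show "AE x in lebesgue. 0 \<le> a \<and> a < b \<longrightarrow> x \<notin> S a b (real (Suc n))"
    proof (cases "0 \<le> a \<and> a < b")
      case True
      have [measurable]: "cbox (- vec (real (Suc n))) (vec (real (Suc n)) :: real^'n) \<in> sets lebesgue" by simp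
      have "S a b (real (Suc n)) \<in> sets lebesgue" unfolding S_def by measurable
      then have "S a b (real (Suc n)) \<in> null_sets lebesgue"
        using emeasure_small_maximal_eq_0[OF assms, of a b "real (Suc n)"] True
        by (auto simp: null_sets_def S_def)
      from AE_not_in[OF this] show ?thesis by eventually_elim auto
    qed auto
  qed
  then show ?thesis
  proof eventually_elim
    case (elim x)
    show ?case
    proof (rule ccontr)
      assume "\<not> eabs h x \<le> maximal h x"
      then have "maximal h x < ennreal \<bar>h x\<bar>" by simp
      then obtain r :: rat where r: "maximal h x < ennreal (real_of_rat r)" "ennreal (real_of_rat r) < ennreal \<bar>h x\<bar>"
        using ennreal_rat_dense by blast
      then obtain q :: rat where q: "maximal h x < ennreal (real_of_rat q)" "ennreal (real_of_rat q) < ennreal (real_of_rat r)"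
        using ennreal_rat_dense by blast
      have q0: "0 < real_of_rat q" using q(1) by (metis ennreal_eq_0_iff not_less_zero not_le)
      then have qr: "real_of_rat q < real_of_rat r" using q(2) by (simp add: ennreal_less_iff)
      have rh: "real_of_rat r \<le> \<bar>h x\<bar>" 
        using iffD1[OF ennreal_less_iff[OF less_imp_le[OF less_trans[OF q0 qr]]] r(2)] by simp
      obtain n :: nat where "norm x \<le> real n" using real_arch_simple by blast
      then have "- real (Suc n) \<le> x $ i \<and> x $ i \<le> real (Suc n)" for i
        using component_le_norm_cart[of x i] by (simp add: abs_le_iff)
      then have "x \<in> cbox (- vec (real (Suc n))) (vec (real (Suc n)))"
        by (simp add: mem_box_cart)
      then have "x \<in> S (real_of_rat q) (real_of_rat r) (real (Suc n))"
        using q(1) rh by (simp add: S_def)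
      with elim q0 qr show False by (metis Rats_of_rat less_imp_le)
    qed
  qed
qed

section \<open>Powers on the extended half-line and Kolmogorov's inequality\<close>

lemma epowr_ennreal: "0 \<le> x \<Longrightarrow> ennreal x epowr a = ennreal (x powr a)"
  by (simp add: epowr_def)

lemma top_epowr [simp]: "\<infinity> epowr a = \<infinity>" "top epowr a = top"
  by (simp_all add: epowr_def)

lemma epowr_mono: "x \<le> y \<Longrightarrow> 0 \<le> a \<Longrightarrow> x epowr a \<le> y epowr a"
  by (cases x; cases y) (auto simp: epowr_ennreal top_unique intro!: ennreal_leI powr_mono2)

lemma borel_measurable_epowr[measurable]:
  assumes [measurable]: "f \<in> borel_measurable M"
  shows "(\<lambda>x. f x epowr a) \<in> borel_measurable M"
  unfolding epowr_def by measurable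

lemma ennreal_suminf_ge_1_eq_top:
  fixes f :: "nat \<Rightarrow> ennreal"
  assumes "\<And>n. 1 \<le> f n"
  shows "(\<Sum>n. f n) = top"
proof (rule ccontr)
  assume "(\<Sum>n. f n) \<noteq> top"
  then obtain N :: nat where N: "(\<Sum>n. f n) < of_nat N"
    using ennreal_Ex_less_of_nat[of "\<Sum>n. f n"] by (auto simp: less_top)
  have "of_nat N = (\<Sum>n<N. 1::ennreal)" by simp
  also have "\<dots> \<le> (\<Sum>n<N. f n)" using assms by (intro sum_mono) auto
  also have "\<dots> \<le> (\<Sum>n. f n)" by (intro sum_le_suminf) auto
  finally show False using N by simp
qed

lemma ennreal_le_suminf:
  fixes f :: "nat \<Rightarrow> ennreal"
  shows "f j \<le> (\<Sum>n. f n)"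
  using sum_le_suminf[of f "{j}"] by simp

text \<open>Where \<open>Z\<close> is at most \<open>T\<close> the trivial bound contributes the
  \<open>1\<close>. The layer \<open>2 ^ k * T < Z \<le> 2 ^ Suc k * T\<close> has measure at most
  \<open>W * q / 2 ^ k\<close>, and on it the power of \<open>Z\<close> is at most
  \<open>T powr d * c k\<close>; these contributions form a geometric series of ratio
  \<open>2 powr (d - 1)\<close>, convergent because \<open>d < 1\<close>.\<close>

lemma Kolmogorov_inequality:
  fixes Z :: "'a \<Rightarrow> ennreal"
  assumes [measurable]: "Z \<in> borel_measurable M" "Q \<in> sets M"
    and q: "emeasure M Q = ennreal q" "0 \<le> q"
    and d: "0 < d" "d < 1" and T: "0 < T" and W: "0 \<le> W"
    and weak: "\<And>t. T \<le> t \<Longrightarrow> ennreal t * emeasure M {y\<in>Q. ennreal t < Z y} \<le> ennreal (W * T * q)"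
  shows "(\<integral>\<^sup>+y\<in>Q. Z y epowr d \<partial>M) \<le> ennreal ((1 + W * 2 powr d / (1 - 2 powr (d - 1))) * T powr d * q)"
proof -
  define c where "c k = 2 powr (d * real (Suc k))" for k
  define E where "E k = {y\<in>Q. ennreal (2 ^ k * T) < Z y}" for k
  have Em[measurable]: "E k \<in> sets M" for k
  proof -
    have "E k = Q \<inter> (Z -` {ennreal (2 ^ k * T)<..} \<inter> space M)"
      using sets.sets_into_space[OF assms(2)] by (auto simp: E_def)
    then show ?thesis by simp
  qed
  have c1: "1 \<le> c k" for k unfolding c_def using d by (intro ge_one_powr_ge_zero) auto
  have pw: "Z y epowr d \<le> ennreal (T powr d) * (1 + (\<Sum>k. ennreal (c k) * indicator (E k) y))"
    if y: "y \<in> Q" for y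
  proof (cases "Z y")
    case (real z)
    show ?thesis
    proof (cases "z \<le> T")
      case True
      then have "Z y epowr d \<le> ennreal (T powr d)"
        using real d by (auto simp: epowr_ennreal intro!: ennreal_leI powr_mono2)
      also have "\<dots> = ennreal (T powr d) * (1 + 0)" by simp
      also have "\<dots> \<le> ennreal (T powr d) * (1 + (\<Sum>k. ennreal (c k) * indicator (E k) y))"
        by (intro mult_left_mono add_left_mono) auto
      finally show ?thesis .
    next
      case False
      have "\<exists>k::nat. z \<le> 2 ^ k * T"
      proof -
        obtain k :: nat where "z / T < 2 ^ k" using real_arch_pow[of 2 "z / T"] by auto
        then show ?thesis using T by (intro exI[of _ k]) (simp add: field_simps)
      qed
      \<comment> \<open>Minimality places \<open>z\<close> above \<open>2 ^ j * T\<close> for the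
        predecessor \<open>j\<close> of \<open>k\<close>, which exists because
        \<open>z > T\<close>.\<close>
      define k where "k = (LEAST k::nat. z \<le> 2 ^ k * T)"
      have k: "z \<le> 2 ^ k * T" unfolding k_def by (rule LeastI_ex) fact
      with False have "k \<noteq> 0" by (cases k) auto
      then obtain j where j: "k = Suc j" by (cases k) auto
      have nj: "2 ^ j * T < z" using not_less_Least[of j "\<lambda>k. z \<le> 2 ^ k * T"] j unfolding k_def by auto
      have "z powr d \<le> (2 ^ Suc j * T) powr d"
        using k j real d by (intro powr_mono2) auto
      also have "(2::real) ^ Suc j = 2 powr real (Suc j)" by (rule powr_realpow[symmetric]) simp
      also have "(2 powr real (Suc j) * T) powr d = T powr d * c j"
        using T by (simp only: c_def powr_mult powr_powr mult.commute)
      finally have "Z y epowr d \<le> ennreal (T powr d * c j)"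
        using real by (simp add: epowr_ennreal ennreal_leI)
      also have "\<dots> = ennreal (T powr d) * (ennreal (c j) * indicator (E j) y)"
      proof -
        have "ennreal (2 ^ j * T) < Z y" unfolding real(2)
          by (subst ennreal_less_iff) (use nj T in auto)
        then have "y \<in> E j" using y unfolding E_def by blast
        then show ?thesis by (simp add: ennreal_mult c_def)
      qed
      also have "\<dots> \<le> ennreal (T powr d) * (\<Sum>k. ennreal (c k) * indicator (E k) y)"
        by (intro mult_left_mono ennreal_le_suminf[of "\<lambda>k. ennreal (c k) * indicator (E k) y"]) simp
      also have "\<dots> \<le> ennreal (T powr d) * (1 + (\<Sum>k. ennreal (c k) * indicator (E k) y))"
        by (intro mult_left_mono) auto
      finally show ?thesis .
    qed
  next
    case top
    \<comment> \<open>An infinite value belongs to all \<open>E k\<close>, and since every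
      \<open>c k\<close> is at least \<open>1\<close> the series is infinite as well.\<close>
    have "y \<in> E k" for k using top y by (simp add: E_def)
    then have "(\<Sum>k. ennreal (c k) * indicator (E k) y) = top"
      using c1 by (intro ennreal_suminf_ge_1_eq_top) simp
    then show ?thesis using T by (simp add: ennreal_mult_top)
  qed
  have geo: "(\<lambda>k. W * q * 2 powr d * (2 powr (d - 1)) ^ k) sums (W * q * 2 powr d * (1 / (1 - 2 powr (d - 1))))"
    using d by (intro sums_mult geometric_sums) (simp add: powr_less_one)
  have cE: "ennreal (c k) * emeasure M (E k) \<le> ennreal (W * q * 2 powr d * (2 powr (d - 1)) ^ k)" for k
  proof -
    have "emeasure M (E k) \<le> emeasure M Q" by (intro emeasure_mono) (auto simp: E_def)
    then obtain m where m: "0 \<le> m" "emeasure M (E k) = ennreal m"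
      using q by (cases "emeasure M (E k)") (auto simp: top_unique)
    have "T * 1 \<le> T * 2 ^ k" using T by (intro mult_left_mono) auto
    then have "ennreal (2 ^ k * T) * ennreal m \<le> ennreal (W * T * q)"
      using weak[of "2 ^ k * T"] m by (simp add: E_def mult.commute)
    then have "2 ^ k * T * m \<le> W * T * q"
      using T m W q by (simp add: ennreal_le_iff flip: ennreal_mult)
    then have "2 ^ k * m \<le> W * q" using T by (simp add: mult.assoc mult.left_commute[of _ T])
    then have "m \<le> W * q / 2 ^ k" by (simp add: field_simps)
    then have "c k * m \<le> c k * (W * q / 2 ^ k)" using c1[of k] by (intro mult_left_mono) auto
    also have "\<dots> = W * q * 2 powr d * (2 powr (d - 1)) ^ k"
      by (simp add: c_def powr_diff power_divide powr_add distrib_left powr_power mult.commute)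
    finally show ?thesis using m c1[of k] by (simp add: ennreal_leI flip: ennreal_mult)
  qed
  have "(\<integral>\<^sup>+y\<in>Q. Z y epowr d \<partial>M)
      \<le> (\<integral>\<^sup>+y. ennreal (T powr d) * (indicator Q y + (\<Sum>k. ennreal (c k) * indicator (E k) y)) \<partial>M)"
    using pw by (intro nn_integral_mono) (auto split: split_indicator)
  also have "\<dots> = ennreal (T powr d) * (emeasure M Q + (\<Sum>k. ennreal (c k) * emeasure M (E k)))"
    by (simp add: nn_integral_cmult nn_integral_add nn_integral_suminf nn_integral_cmult_indicator)
  also have "\<dots> \<le> ennreal (T powr d) * (emeasure M Q + (\<Sum>k. ennreal (W * q * 2 powr d * (2 powr (d - 1)) ^ k)))"
    by (intro mult_left_mono add_left_mono suminf_le cE) auto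
  also have "(\<Sum>k. ennreal (W * q * 2 powr d * (2 powr (d - 1)) ^ k))
      = ennreal (W * q * 2 powr d * (1 / (1 - 2 powr (d - 1))))"
    using geo W q by (intro suminf_ennreal_eq) auto
  also have "ennreal (T powr d) * (emeasure M Q + \<dots>)
      = ennreal (T powr d * (q + W * q * 2 powr d * (1 / (1 - 2 powr (d - 1)))))"
    using q W d powr_less_one[of 2 "d - 1"] by (subst ennreal_mult) (auto simp flip: ennreal_plus)
  also have "T powr d * (q + W * q * 2 powr d * (1 / (1 - 2 powr (d - 1))))
      = (1 + W * 2 powr d / (1 - 2 powr (d - 1))) * T powr d * q"
    by (simp add: algebra_simps)
  finally show ?thesis .
qed

text \<open>A cube through \<open>y\<close> with average above \<open>t\<close> has side at most
  \<open>r\<close>: otherwise its concentric triple would contain \<open>x\<close> and, having only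
  \<open>3 ^ CARD('n)\<close> times the volume, would push \<open>maximal h x\<close> above
  \<open>A\<close>. Such short cubes through \<open>y\<close> stay inside the tripled cube, so
  cutting \<open>h\<close> off outside it leaves their averages unchanged.\<close>

lemma maximal_localize:
  fixes h :: "real^'n \<Rightarrow> real"
  assumes r: "0 < r" and x: "x \<in> cbox a (a + vec r)" and y: "y \<in> cbox a (a + vec r)"
    and A: "maximal h x \<le> ennreal A" "0 \<le> A" and t: "3 ^ CARD('n) * A \<le> t" and ty: "ennreal t < maximal h y"
  shows "ennreal t < maximal (\<lambda>z. indicat_real (cbox (a - vec r) (a - vec r + vec (3 * r))) z * h z) y"
proof -
  let ?d = "CARD('n)" and ?P = "cbox (a - vec r) (a - vec r + vec (3 * r))"
  obtain b s where bs: "0 < s" "y \<in> cbox b (b + vec s)"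
    "ennreal t * ennreal (s ^ ?d) < (\<integral>\<^sup>+z\<in>cbox b (b + vec s). eabs h z \<partial>lebesgue)"
    using ty by (rule less_maximalE)
  let ?R = "cbox b (b + vec s)"
  have t0: "0 \<le> t" using A(2) by (intro order_trans[OF _ t]) simp
  have sr: "s \<le> r"
  proof (rule ccontr)
    assume "\<not> s \<le> r"
    then have rs: "r < s" by simp
    let ?R3 = "cbox (b - vec s) (b - vec s + vec (3 * s))"
    have R3: "?R3 \<in> cubes" unfolding cubes_def using bs(1) by (auto intro!: exI[of _ "3 * s"])
    have "b $ i - s \<le> x $ i \<and> x $ i \<le> b $ i - s + 3 * s" for i
    proof -
      have "a $ i \<le> x $ i" "x $ i \<le> a $ i + r" "a $ i \<le> y $ i" "y $ i \<le> a $ i + r"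
        "b $ i \<le> y $ i" "y $ i \<le> b $ i + s"
        using x y bs(2) by (auto simp: mem_box_cart)
      then show ?thesis using rs by linarith
    qed
    then have xR: "x \<in> ?R3" by (simp add: mem_box_cart)
    have sub: "z \<in> ?R3" if "z \<in> ?R" for z
    proof -
      have "b $ i - s \<le> z $ i \<and> z $ i \<le> b $ i - s + 3 * s" for i
      proof -
        have "b $ i \<le> z $ i" "z $ i \<le> b $ i + s" using that by (auto simp: mem_box_cart)
        then show ?thesis using bs(1) by linarith
      qed
      then show ?thesis by (simp add: mem_box_cart)
    qed
    have "(\<integral>\<^sup>+z\<in>?R. eabs h z \<partial>lebesgue) \<le> (\<integral>\<^sup>+z\<in>?R3. eabs h z \<partial>lebesgue)"
      using sub by (intro nn_integral_mono) (auto split: split_indicator)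
    also have "\<dots> \<le> maximal h x * emeasure lebesgue ?R3"
      by (rule integral_le_maximal[OF R3 xR])
    also have "\<dots> \<le> ennreal A * emeasure lebesgue ?R3" using A by (intro mult_right_mono) auto
    also have "\<dots> = ennreal (A * 3 ^ ?d * s ^ ?d)"
      using bs(1) A by (simp add: emeasure_cube ennreal_mult power_mult_distrib mult.assoc)
    also have "\<dots> \<le> ennreal (t * s ^ ?d)"
      using t bs(1) by (intro ennreal_leI mult_right_mono) (auto simp: mult.commute)
    also have "\<dots> = ennreal t * ennreal (s ^ ?d)"
      using bs(1) t0 by (intro ennreal_mult) auto
    finally show False using bs(3) by simp
  qed
  have sub: "z \<in> ?P" if "z \<in> ?R" for z
  proof -
    have "a $ i - r \<le> z $ i \<and> z $ i \<le> a $ i - r + 3 * r" for i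
    proof -
      have "a $ i \<le> y $ i" "y $ i \<le> a $ i + r" "b $ i \<le> y $ i" "y $ i \<le> b $ i + s"
        "b $ i \<le> z $ i" "z $ i \<le> b $ i + s"
        using that y bs(2) by (auto simp: mem_box_cart)
      then show ?thesis using sr by linarith
    qed
    then show ?thesis by (simp add: mem_box_cart)
  qed
  have R: "?R \<in> cubes" unfolding cubes_def using bs(1) by auto
  have "(\<integral>\<^sup>+z\<in>?R. eabs h z \<partial>lebesgue) \<le> (\<integral>\<^sup>+z\<in>?R. eabs (\<lambda>z. indicat_real ?P z * h z) z \<partial>lebesgue)"
    using sub by (intro nn_integral_mono) (auto split: split_indicator)
  also have "\<dots> \<le> maximal (\<lambda>z. indicat_real ?P z * h z) y * emeasure lebesgue ?R"
    by (rule integral_le_maximal[OF R bs(2)])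
  finally have "ennreal t * ennreal (s ^ ?d)
      < maximal (\<lambda>z. indicat_real ?P z * h z) y * ennreal (s ^ ?d)"
    using bs by (simp add: emeasure_cube less_le_trans)
  then show ?thesis by (meson mult_right_mono not_le zero_le)
qed

text \<open>Above the height \<open>T\<close> the level sets of \<open>maximal h\<close> inside \<open>Q\<close> see only the values of \<open>h\<close> on
  the tripled cube \<open>P\<close>, so the weak type inequality controls them by \<open>maximal h x\<close>.\<close>

lemma Coifman_Rochberg:
  assumes d: "0 < d" "d < 1"
  obtains C where "0 < C"
    "\<And>(h :: real^'n \<Rightarrow> real) Q x A. h \<in> borel_measurable lebesgue \<Longrightarrow> Q \<in> cubes \<Longrightarrow> x \<in> Q \<Longrightarrow> 0 < A \<Longrightarrow>
      maximal h x \<le> ennreal A \<Longrightarrow>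
      (\<integral>\<^sup>+y\<in>Q. maximal h y epowr d \<partial>lebesgue) \<le> ennreal (C * A powr d) * emeasure lebesgue Q"
proof
  let ?d = "CARD('n)"
  define W where "W = (10 * real ?d) ^ ?d"
  define C where "C = (1 + W * 2 powr d / (1 - 2 powr (d - 1))) * (3 ^ ?d) powr d"
  have W: "0 \<le> W" by (simp add: W_def)
  have less1: "2 powr (d - 1) < 1" using d by (simp add: powr_less_one)
  have "0 \<le> W * 2 powr d / (1 - 2 powr (d - 1))" using W less1 by simp
  then show "0 < C" by (simp add: C_def add_pos_nonneg)
  fix h :: "real^'n \<Rightarrow> real" and Q x A
  assume h[measurable]: "h \<in> borel_measurable lebesgue" and Q: "Q \<in> cubes" and x: "x \<in> Q" and A: "0 < A"
    and M: "maximal h x \<le> ennreal A"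
  obtain a r where ar: "Q = cbox a (a + vec r)" "0 < r" using Q by (rule cubesE)
  define P where "P = cbox (a - vec r) (a - vec r + vec (3 * r))"
  have Pc: "P \<in> cubes" unfolding cubes_def P_def using ar(2) by (auto intro!: exI[of _ "3 * r"])
  have [measurable]: "P \<in> sets lebesgue" "Q \<in> sets lebesgue" using Pc Q by (auto intro: cube_sets)
  have "a $ i - r \<le> x $ i \<and> x $ i \<le> a $ i - r + 3 * r" for i
  proof -
    have "a $ i \<le> x $ i" "x $ i \<le> a $ i + r" using x ar by (auto simp: mem_box_cart)
    then show ?thesis using ar(2) by linarith
  qed
  then have xP: "x \<in> P" by (simp add: mem_box_cart P_def)
  \<comment> \<open>\<open>T\<close> has two roles: above this height
    \<open>maximal_localize\<close> applies, and \<open>T * q\<close> bounds the integral of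
    \<open>\<bar>h\<bar>\<close> over \<open>P\<close>, whose volume is \<open>3 ^ ?d * q\<close>.
    It is also the origin of the factor \<open>(3 ^ ?d) powr d\<close> in \<open>C\<close>.\<close>
  define T where "T = 3 ^ ?d * A"
  define q where "q = r ^ ?d"
  have T: "0 < T" using A by (simp add: T_def)
  have q: "emeasure lebesgue Q = ennreal q" "0 \<le> q" using ar by (auto simp: emeasure_cube q_def)
  let ?h = "\<lambda>z. indicat_real P z * h z"
  have int: "(\<integral>\<^sup>+z. eabs ?h z \<partial>lebesgue) \<le> ennreal (T * q)"
  proof -
    have "(\<integral>\<^sup>+z. eabs ?h z \<partial>lebesgue) = (\<integral>\<^sup>+z\<in>P. eabs h z \<partial>lebesgue)"
      by (intro nn_integral_cong) (auto split: split_indicator)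
    also have "\<dots> \<le> maximal h x * emeasure lebesgue P" by (rule integral_le_maximal[OF Pc xP])
    also have "\<dots> \<le> ennreal A * emeasure lebesgue P" using M by (intro mult_right_mono) auto
    also have "\<dots> = ennreal (T * q)"
      using ar(2) A by (simp add: P_def emeasure_cube T_def q_def ennreal_mult power_mult_distrib mult_ac)
    finally show ?thesis .
  qed
  have weak: "ennreal t * emeasure lebesgue {y\<in>Q. ennreal t < maximal h y} \<le> ennreal (W * T * q)"
    if t: "T \<le> t" for t
  proof -
    have "{y\<in>Q. ennreal t < maximal h y} \<subseteq> {y. ennreal t < maximal ?h y}"
      using maximal_localize[OF ar(2), of x a _ h A t] x M A t by (auto simp: ar(1) P_def T_def)
    then have "ennreal t * emeasure lebesgue {y\<in>Q. ennreal t < maximal h y}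
        \<le> ennreal t * emeasure lebesgue {y. ennreal t < maximal ?h y}"
      by (intro mult_left_mono emeasure_mono) auto
    also have "\<dots> \<le> ennreal W * (\<integral>\<^sup>+z. eabs ?h z \<partial>lebesgue)"
      unfolding W_def using t T by (intro weak_type_maximal) auto
    also have "\<dots> \<le> ennreal W * ennreal (T * q)" by (intro mult_left_mono int) auto
    also have "\<dots> = ennreal (W * T * q)" using W T q by (simp add: ennreal_mult mult.assoc)
    finally show ?thesis .
  qed
  have "(\<integral>\<^sup>+y\<in>Q. maximal h y epowr d \<partial>lebesgue)
      \<le> ennreal ((1 + W * 2 powr d / (1 - 2 powr (d - 1))) * T powr d * q)"
    by (rule Kolmogorov_inequality[OF _ _ q d T W weak]) auto
  also have "(1 + W * 2 powr d / (1 - 2 powr (d - 1))) * T powr d * q = (C * A powr d) * q"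
    using A by (simp add: C_def T_def powr_mult mult_ac)
  also have "ennreal (C * A powr d * q) = ennreal (C * A powr d) * ennreal q"
    using \<open>0 < C\<close> q by (intro ennreal_mult) auto
  finally show "(\<integral>\<^sup>+y\<in>Q. maximal h y epowr d \<partial>lebesgue) \<le> ennreal (C * A powr d) * emeasure lebesgue Q"
    using q by simp
qed

section \<open>Muckenhoupt weights\<close>

text \<open>The A_1 condition without reciprocals or essential suprema. The average is named as a
  positive real \<open>a\<close> so that later computations can divide by it.\<close>

definition A1_weight :: "real \<Rightarrow> (real^'n \<Rightarrow> real) \<Rightarrow> bool" where
  "A1_weight C u \<longleftrightarrow> u \<in> borel_measurable lebesgue \<and> (AE x in lebesgue. 0 < u x) \<and>
     (\<forall>Q\<in>cubes. \<exists>a>0. avg Q (\<lambda>x. ennreal (u x)) = ennreal a \<and> (AE x in lebesgue. x \<in> Q \<longrightarrow> a \<le> C * u x))"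

lemma A1_weightE:
  assumes "A1_weight C u" "Q \<in> cubes"
  obtains a where "0 < a" "avg Q (\<lambda>x. ennreal (u x)) = ennreal a"
    "AE x in lebesgue. x \<in> Q \<longrightarrow> a \<le> C * u x"
proof -
  have "\<exists>a>0. avg Q (\<lambda>x. ennreal (u x)) = ennreal a \<and> (AE x in lebesgue. x \<in> Q \<longrightarrow> a \<le> C * u x)"
    using assms unfolding A1_weight_def by (elim conjE) (rule bspec)
  then show ?thesis by (elim exE conjE) (rule that)
qed

lemma avg_le_cmult:
  assumes Q: "Q \<in> cubes" and g[measurable]: "g \<in> borel_measurable lebesgue"
    and le: "AE x in lebesgue. x \<in> Q \<longrightarrow> f x \<le> k * g x"
  shows "avg Q f \<le> k * avg Q g"
proof -
  have [measurable]: "Q \<in> sets lebesgue" using Q by (rule cube_sets)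
  have "(\<integral>\<^sup>+x\<in>Q. f x \<partial>lebesgue) \<le> (\<integral>\<^sup>+x. k * (g x * indicator Q x) \<partial>lebesgue)"
    using le by (intro nn_integral_mono_AE) (auto split: split_indicator elim!: eventually_mono)
  also have "\<dots> = k * (\<integral>\<^sup>+x\<in>Q. g x \<partial>lebesgue)" by (intro nn_integral_cmult) measurable
  finally show ?thesis
    unfolding avg_def by (metis ennreal_times_divide divide_right_mono_ennreal)
qed

text \<open>On a cube with averages \<open>a1\<close> and \<open>a2\<close>, almost everywhere
  \<open>u1 \<ge> a1 / C1\<close> and \<open>u2 \<ge> a2 / C2\<close>. The second bound controls the
  negative power of \<open>u2\<close> in \<open>w\<close>, the first the negative power of
  \<open>u1\<close> in the reciprocal of \<open>w\<close>. What remains are averages of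
  \<open>u1\<close> and, for \<open>p > 1\<close>, of \<open>u2\<close>, and all powers of
  \<open>a1\<close> and \<open>a2\<close> cancel.\<close>

lemma A1_factorization:
  fixes u1 u2 :: "real^'n \<Rightarrow> real"
  assumes p: "1 \<le> p" and u1: "A1_weight C1 u1" and u2: "A1_weight C2 u2" and C: "0 < C1" "0 < C2"
  defines "w \<equiv> \<lambda>x. u1 x * u2 x powr (1 - p)"
  shows "weight w" and "Ap_const p w \<le> ennreal (C1 * C2 powr (p - 1))"
proof -
  have m[measurable]: "u1 \<in> borel_measurable lebesgue" "u2 \<in> borel_measurable lebesgue"
    and pos: "AE x in lebesgue. 0 < u1 x" "AE x in lebesgue. 0 < u2 x"
    using u1 u2 by (auto simp: A1_weight_def)
  have wm[measurable]: "w \<in> borel_measurable lebesgue" unfolding w_def by measurable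
  have wpos: "AE x in lebesgue. 0 < w x"
    using pos by eventually_elim (simp add: w_def)
  have ex: "\<exists>a1 a2. 0 < a1 \<and> 0 < a2 \<and> avg Q (\<lambda>x. ennreal (u1 x)) = ennreal a1 \<and>
      avg Q (\<lambda>x. ennreal (u2 x)) = ennreal a2 \<and>
      (AE x in lebesgue. x \<in> Q \<longrightarrow> a1 / C1 \<le> u1 x \<and> a2 / C2 \<le> u2 x)" if Q: "Q \<in> cubes" for Q
  proof -
    obtain a1 where a1: "0 < a1" "avg Q (\<lambda>x. ennreal (u1 x)) = ennreal a1"
      "AE x in lebesgue. x \<in> Q \<longrightarrow> a1 \<le> C1 * u1 x"
      by (rule A1_weightE[OF u1 Q])
    obtain a2 where a2: "0 < a2" "avg Q (\<lambda>x. ennreal (u2 x)) = ennreal a2"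
      "AE x in lebesgue. x \<in> Q \<longrightarrow> a2 \<le> C2 * u2 x"
      by (rule A1_weightE[OF u2 Q])
    have "AE x in lebesgue. x \<in> Q \<longrightarrow> a1 / C1 \<le> u1 x \<and> a2 / C2 \<le> u2 x"
      using a1(3) a2(3) by eventually_elim (use C in \<open>auto simp: field_simps\<close>)
    then show ?thesis using a1 a2 by blast
  qed
  have avgw: "avg Q (\<lambda>x. ennreal (w x)) \<le> ennreal (a1 * (a2 / C2) powr (1 - p))"
    if Q: "Q \<in> cubes" and a: "0 < a1" "0 < a2" "avg Q (\<lambda>x. ennreal (u1 x)) = ennreal a1"
      "AE x in lebesgue. x \<in> Q \<longrightarrow> a1 / C1 \<le> u1 x \<and> a2 / C2 \<le> u2 x" for Q a1 a2
  proof -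
    have "avg Q (\<lambda>x. ennreal (w x)) \<le> ennreal ((a2 / C2) powr (1 - p)) * avg Q (\<lambda>x. ennreal (u1 x))"
    proof (rule avg_le_cmult[OF Q])
      show "AE x in lebesgue. x \<in> Q \<longrightarrow> ennreal (w x) \<le> ennreal ((a2 / C2) powr (1 - p)) * ennreal (u1 x)"
        using a(4) pos
      proof eventually_elim
        case (elim x)
        show ?case
        proof
          assume "x \<in> Q"
          then have "u2 x powr (1 - p) \<le> (a2 / C2) powr (1 - p)"
            using elim p a C by (intro powr_mono2') auto
          then have "w x \<le> (a2 / C2) powr (1 - p) * u1 x"
            using elim by (simp add: w_def mult.commute mult_right_mono)
          then show "ennreal (w x) \<le> ennreal ((a2 / C2) powr (1 - p)) * ennreal (u1 x)"
            using elim by (simp add: ennreal_leI flip: ennreal_mult)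
        qed
      qed
    qed measurable
    also have "\<dots> = ennreal (a1 * (a2 / C2) powr (1 - p))"
      using a by (simp add: ennreal_mult mult.commute)
    finally show ?thesis .
  qed
  have fin: "(\<integral>\<^sup>+x\<in>Q. ennreal (w x) \<partial>lebesgue) < \<infinity>" if Q: "Q \<in> cubes" for Q
  proof -
    obtain a1 a2 where a: "0 < a1" "0 < a2" "avg Q (\<lambda>x. ennreal (u1 x)) = ennreal a1"
      "AE x in lebesgue. x \<in> Q \<longrightarrow> a1 / C1 \<le> u1 x \<and> a2 / C2 \<le> u2 x" using ex[OF Q] by blast
    have "avg Q (\<lambda>x. ennreal (w x)) < \<infinity>" using avgw[OF Q a] by (rule le_less_trans) simp
    moreover obtain q where "0 < q" "emeasure lebesgue Q = ennreal q" using Q by (rule emeasure_cubeE)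
    ultimately show ?thesis
      by (simp add: ennreal_mult_less_top flip: avg_mult_emeasure[OF Q])
  qed
  show "weight w" unfolding weight_def using wpos fin by auto
  show "Ap_const p w \<le> ennreal (C1 * C2 powr (p - 1))"
  proof (cases "p = 1")
    case True
    have "avg Q (\<lambda>x. ennreal (w x)) * esssup (lebesgue_on Q) (\<lambda>x. inverse (ennreal (w x))) \<le> ennreal C1"
      if Q: "Q \<in> cubes" for Q
    proof -
      have [measurable]: "Q \<in> sets lebesgue" using Q by (rule cube_sets)
      obtain a1 a2 where a: "0 < a1" "0 < a2" "avg Q (\<lambda>x. ennreal (u1 x)) = ennreal a1"
        "AE x in lebesgue. x \<in> Q \<longrightarrow> a1 / C1 \<le> u1 x \<and> a2 / C2 \<le> u2 x" using ex[OF Q] by blast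
      have "avg Q (\<lambda>x. ennreal (w x)) \<le> ennreal a1" using avgw[OF Q a] True a C by simp
      moreover have "esssup (lebesgue_on Q) (\<lambda>x. inverse (ennreal (w x))) \<le> ennreal (C1 / a1)"
      proof (rule esssup_I)
        show "(\<lambda>x. inverse (ennreal (w x))) \<in> borel_measurable (lebesgue_on Q)"
          by (intro measurable_restrict_space1) measurable
        \<comment> \<open>\<open>0 powr 0\<close> is \<open>0\<close>, so at \<open>p = 1\<close>
          the factor \<open>u2 x powr (1 - p)\<close> equals \<open>1\<close> only where
          \<open>u2\<close> is positive, that is almost everywhere.\<close>
        have "AE x in lebesgue. x \<in> Q \<longrightarrow> inverse (ennreal (w x)) \<le> ennreal (C1 / a1)"
          using a(4) pos
        proof eventually_elim
          case (elim x)
          show ?case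
          proof
            assume "x \<in> Q"
            then have *: "a1 / C1 \<le> u1 x" using elim by auto
            have "inverse (u1 x) \<le> inverse (a1 / C1)" using * a C by (intro le_imp_inverse_le) auto
            then show "inverse (ennreal (w x)) \<le> ennreal (C1 / a1)"
              using elim True by (simp add: w_def inverse_ennreal ennreal_leI)
          qed
        qed
        then show "AE x in lebesgue_on Q. inverse (ennreal (w x)) \<le> ennreal (C1 / a1)"
          by (simp add: AE_restrict_space_iff)
      qed
      ultimately have "avg Q (\<lambda>x. ennreal (w x)) * esssup (lebesgue_on Q) (\<lambda>x. inverse (ennreal (w x)))
          \<le> ennreal a1 * ennreal (C1 / a1)" by (intro mult_mono) auto
      also have "\<dots> = ennreal C1" using a C by (simp flip: ennreal_mult)
      finally show ?thesis .
    qed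
    then show ?thesis using True C by (simp add: Ap_const_def SUP_le_iff)
  next
    case False
    then have p1: "1 < p" using p by simp
    have "avg Q (\<lambda>x. ennreal (w x)) *
        avg Q (\<lambda>x. inverse (ennreal (w x)) epowr (1 / (p - 1))) epowr (p - 1)
        \<le> ennreal (C1 * C2 powr (p - 1))" if Q: "Q \<in> cubes" for Q
    proof -
      obtain a1 a2 where a: "0 < a1" "0 < a2" "avg Q (\<lambda>x. ennreal (u1 x)) = ennreal a1"
        "AE x in lebesgue. x \<in> Q \<longrightarrow> a1 / C1 \<le> u1 x \<and> a2 / C2 \<le> u2 x"
        "avg Q (\<lambda>x. ennreal (u2 x)) = ennreal a2" using ex[OF Q] by blast
      \<comment> \<open>An upper bound on \<open>Q\<close> for \<open>u1\<close> to the power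
        \<open>- 1 / (p - 1)\<close>; the power of \<open>u2\<close> that accompanies it in the
        reciprocal weight is exactly \<open>1\<close>.\<close>
      define k where "k = (a1 / C1) powr (- 1 / (p - 1))"
      have k: "0 < k" using a C by (simp add: k_def)
      have "avg Q (\<lambda>x. inverse (ennreal (w x)) epowr (1 / (p - 1)))
          \<le> ennreal k * avg Q (\<lambda>x. ennreal (u2 x))"
      proof (rule avg_le_cmult[OF Q])
        show "AE x in lebesgue. x \<in> Q \<longrightarrow>
            inverse (ennreal (w x)) epowr (1 / (p - 1)) \<le> ennreal k * ennreal (u2 x)"
          using a(4) pos
        proof eventually_elim
          case (elim x)
          show ?case
          proof
            assume "x \<in> Q"
            then have *: "a1 / C1 \<le> u1 x" using elim by auto
            have w0: "0 < w x" using elim by (simp add: w_def)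
            have "inverse (w x) powr (1 / (p - 1)) = w x powr (- 1 / (p - 1))"
              using w0 by (simp add: powr_minus inverse_powr minus_divide_left[symmetric])
            also have "\<dots> = u1 x powr (- 1 / (p - 1)) * (u2 x powr ((1 - p) * (- 1 / (p - 1))))"
              using elim by (simp add: w_def powr_mult powr_powr)
            also have "(1 - p) * (- 1 / (p - 1)) = 1" using p1 by (simp add: field_simps)
            also have "u1 x powr (- 1 / (p - 1)) * (u2 x powr 1) = u1 x powr (- 1 / (p - 1)) * u2 x"
              using elim by simp
            also have "\<dots> \<le> k * u2 x"
              unfolding k_def using elim * a C p1 by (intro mult_right_mono powr_mono2') auto
            finally have "inverse (w x) powr (1 / (p - 1)) \<le> k * u2 x" .
            then show "inverse (ennreal (w x)) epowr (1 / (p - 1)) \<le> ennreal k * ennreal (u2 x)"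
              using elim w0 k by (simp add: inverse_ennreal epowr_ennreal ennreal_leI flip: ennreal_mult)
          qed
        qed
      qed measurable
      also have "\<dots> = ennreal (k * a2)" using a k by (simp add: ennreal_mult)
      finally have "avg Q (\<lambda>x. inverse (ennreal (w x)) epowr (1 / (p - 1))) epowr (p - 1)
          \<le> ennreal (k * a2) epowr (p - 1)" using p1 by (intro epowr_mono) auto
      also have "\<dots> = ennreal (C1 / a1 * a2 powr (p - 1))"
      proof -
        have "k powr (p - 1) = (a1 / C1) powr (- 1)"
          unfolding k_def powr_powr using p1 by simp
        also have "\<dots> = C1 / a1" using a C by (simp add: powr_minus field_simps)
        finally show ?thesis using a k by (simp add: epowr_ennreal powr_mult)
      qed
      finally have "avg Q (\<lambda>x. ennreal (w x)) *
          avg Q (\<lambda>x. inverse (ennreal (w x)) epowr (1 / (p - 1))) epowr (p - 1)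
          \<le> ennreal (a1 * (a2 / C2) powr (1 - p)) * ennreal (C1 / a1 * a2 powr (p - 1))"
        using avgw[OF Q a(1-4)] by (intro mult_mono) auto
      also have "\<dots> = ennreal (a1 * (a2 / C2) powr (1 - p) * (C1 / a1 * a2 powr (p - 1)))"
        using a C by (intro ennreal_mult[symmetric]) auto
      also have "a1 * (a2 / C2) powr (1 - p) * (C1 / a1 * a2 powr (p - 1))
          = C1 * C2 powr (p - 1) * (a2 powr (1 - p) * a2 powr (p - 1))"
      proof -
        have "(a2 / C2) powr (1 - p) = a2 powr (1 - p) * C2 powr (p - 1)"
          using a C by (simp add: powr_divide powr_diff field_simps)
        then show ?thesis using a C by (simp add: field_simps)
      qed
      also have "a2 powr (1 - p) * a2 powr (p - 1) = 1" using a by (simp flip: powr_add)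
      finally show ?thesis by simp
    qed
    then show ?thesis using False by (simp add: Ap_const_def SUP_le_iff)
  qed
qed

text \<open>A zero of the maximal function at the single point \<open>x\<close> makes the integrals
  of \<open>\<bar>h\<bar>\<close> over the cubes centred at \<open>x\<close> vanish, and these cubes
  exhaust the space.\<close>

lemma maximal_pos:
  fixes h :: "real^'n \<Rightarrow> real"
  assumes [measurable]: "h \<in> borel_measurable lebesgue" and nz: "\<not> (AE x in lebesgue. h x = 0)"
  shows "0 < maximal h x"
proof (rule ccontr)
  assume "\<not> 0 < maximal h x"
  then have M: "maximal h x = 0" by (simp add: not_gr_zero)
  define Q where "Q n = cbox (x - vec (real (Suc n))) (x - vec (real (Suc n)) + vec (2 * real (Suc n)))" for n :: nat
  have Qc: "Q n \<in> cubes" for n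
    unfolding cubes_def Q_def
    by (rule CollectI, intro exI[of _ "x - vec (real (Suc n))"] exI[of _ "2 * real (Suc n)"]) simp
  have xQ: "x \<in> Q n" for n by (simp add: Q_def mem_box_cart)
  have "AE y in lebesgue. \<forall>n. y \<in> Q n \<longrightarrow> h y = 0"
  proof (intro AE_all_countable[THEN iffD2] allI)
    fix n
    have [measurable]: "Q n \<in> sets lebesgue" using Qc by (rule cube_sets)
    have "(\<integral>\<^sup>+y\<in>Q n. eabs h y \<partial>lebesgue) \<le> maximal h x * emeasure lebesgue (Q n)"
      by (rule integral_le_maximal[OF Qc xQ])
    then have "(\<integral>\<^sup>+y\<in>Q n. eabs h y \<partial>lebesgue) = 0" using M by simp
    then have "AE y in lebesgue. eabs h y * indicator (Q n) y = 0"
      by (subst (asm) nn_integral_0_iff_AE) measurable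
    then show "AE y in lebesgue. y \<in> Q n \<longrightarrow> h y = 0"
      by eventually_elim (auto split: split_indicator_asm)
  qed
  then have "AE y in lebesgue. h y = 0"
  proof eventually_elim
    case (elim y)
    obtain n :: nat where n: "norm (y - x) \<le> real n" using real_arch_simple by blast
    have "x $ i - real (Suc n) \<le> y $ i \<and> y $ i \<le> x $ i - real (Suc n) + 2 * real (Suc n)" for i
      using component_le_norm_cart[of "y - x" i] n by (simp add: abs_le_iff)
    then have "y \<in> Q n" by (simp add: Q_def mem_box_cart)
    with elim show ?case by blast
  qed
  with nz show False by simp
qed

text \<open>\<open>enn2real\<close> replaces infinite values by \<open>0\<close>, but only on a null
  set. Elsewhere the weight is positive by \<open>maximal_pos\<close>, and the Coifman-Rochberg
  bound at each remaining point of the cube is the A_1 condition.\<close>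

lemma A1_weight_maximal:
  assumes d: "0 < d" "d < 1"
  obtains C where "0 < C"
    "\<And>h :: real^'n \<Rightarrow> real. h \<in> borel_measurable lebesgue \<Longrightarrow> \<not> (AE x in lebesgue. h x = 0) \<Longrightarrow>
      (AE x in lebesgue. maximal h x < \<infinity>) \<Longrightarrow> A1_weight C (\<lambda>x. enn2real (maximal h x epowr d))"
proof -
  obtain C where C: "0 < C" and CR:
    "\<And>(h :: real^'n \<Rightarrow> real) Q x A. h \<in> borel_measurable lebesgue \<Longrightarrow> Q \<in> cubes \<Longrightarrow> x \<in> Q \<Longrightarrow> 0 < A \<Longrightarrow>
      maximal h x \<le> ennreal A \<Longrightarrow>
      (\<integral>\<^sup>+y\<in>Q. maximal h y epowr d \<partial>lebesgue) \<le> ennreal (C * A powr d) * emeasure lebesgue Q"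
    using Coifman_Rochberg[OF d, where ?'n = 'n] by blast
  have "A1_weight C (\<lambda>x. enn2real (maximal h x epowr d))"
    if h[measurable]: "h \<in> borel_measurable lebesgue" and nz: "\<not> (AE x in lebesgue. h x = 0)"
      and fin: "AE x in lebesgue. maximal h x < \<infinity>" for h :: "real^'n \<Rightarrow> real"
  proof -
    define u where "u x = enn2real (maximal h x epowr d)" for x
    have um[measurable]: "u \<in> borel_measurable lebesgue" unfolding u_def by measurable
    have u_eq: "\<exists>A>0. maximal h x = ennreal A \<and> u x = A powr d" if "maximal h x < \<infinity>" for x
      using that maximal_pos[OF h nz, of x]
      by (cases "maximal h x") (auto simp: u_def epowr_ennreal)
    have upos: "0 < u x" if "maximal h x < \<infinity>" for x using u_eq[OF that] by auto
    have u_pow: "ennreal (u x) = maximal h x epowr d" if "maximal h x < \<infinity>" for x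
      using u_eq[OF that] by (auto simp: epowr_ennreal)
    have "\<exists>a>0. avg Q (\<lambda>x. ennreal (u x)) = ennreal a \<and> (AE x in lebesgue. x \<in> Q \<longrightarrow> a \<le> C * u x)"
      if Q: "Q \<in> cubes" for Q
    proof -
      have [measurable]: "Q \<in> sets lebesgue" using Q by (rule cube_sets)
      obtain q where q: "0 < q" "emeasure lebesgue Q = ennreal q" using Q by (rule emeasure_cubeE)
      have eq: "(\<integral>\<^sup>+y\<in>Q. ennreal (u y) \<partial>lebesgue) = (\<integral>\<^sup>+y\<in>Q. maximal h y epowr d \<partial>lebesgue)"
        using fin by (intro nn_integral_cong_AE) (auto elim!: eventually_mono simp: u_pow)
      have bound: "avg Q (\<lambda>x. ennreal (u x)) \<le> ennreal (C * u x)" if x: "x \<in> Q" "maximal h x < \<infinity>" for x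
      proof -
        obtain A where "0 < A" "maximal h x = ennreal A" "u x = A powr d" using u_eq[OF x(2)] by blast
        then show ?thesis
          using CR[OF h Q x(1), of A] by (simp add: avg_le_iff[OF Q] eq)
      qed
      have "\<not> (AE x in lebesgue. \<not> (x \<in> Q))"
      proof
        assume "AE x in lebesgue. \<not> (x \<in> Q)"
        then have "emeasure lebesgue Q = 0"
          using AE_iff_measurable[of Q lebesgue "\<lambda>x. x \<notin> Q"] by auto
        with q show False by simp
      qed
      \<comment> \<open>A cube has positive measure, so it contains a point where the maximal
        function is finite; the bound at that single point makes the average finite.\<close>
      then obtain x0 where x0: "x0 \<in> Q" "maximal h x0 < \<infinity>"
        using fin eventually_mono[OF fin, of "\<lambda>x. x \<notin> Q"] by blast
      obtain a where a: "0 \<le> a" "avg Q (\<lambda>x. ennreal (u x)) = ennreal a"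
        using bound[OF x0] by (cases "avg Q (\<lambda>x. ennreal (u x))") (auto simp: top_unique)
      have "a \<noteq> 0"
      proof
        assume "a = 0"
        then have "(\<integral>\<^sup>+y\<in>Q. ennreal (u y) \<partial>lebesgue) = 0"
          using a avg_mult_emeasure[OF Q, of "\<lambda>x. ennreal (u x)"] by simp
        then have "AE y in lebesgue. ennreal (u y) * indicator Q y = 0"
          by (subst (asm) nn_integral_0_iff_AE) measurable
        with fin have "AE y in lebesgue. \<not> (y \<in> Q)"
          by eventually_elim (use upos in \<open>force split: split_indicator_asm\<close>)
        with \<open>\<not> (AE x in lebesgue. \<not> (x \<in> Q))\<close> show False by simp
      qed
      moreover have "AE x in lebesgue. x \<in> Q \<longrightarrow> a \<le> C * u x"
        using fin
      proof eventually_elim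
        case (elim x)
        show ?case
        proof
          assume "x \<in> Q"
          then have "ennreal a \<le> ennreal (C * u x)" using bound[of x] elim a by simp
          then show "a \<le> C * u x" using C upos[OF elim] by (simp add: ennreal_le_iff)
        qed
      qed
      ultimately show ?thesis using a by (intro exI[of _ a]) auto
    qed
    moreover have "AE x in lebesgue. 0 < u x" using fin by eventually_elim (rule upos)
    ultimately show ?thesis using um unfolding A1_weight_def u_def by blast
  qed
  with C that show ?thesis by blast
qed

section \<open>Duality and rearrangement\<close>

lemma sigma_finite_lebesgue: "sigma_finite_measure (lebesgue :: 'a::euclidean_space measure)"
proof
  obtain A :: "'a set set" where A: "countable A" "A \<subseteq> sets lborel" "\<Union>A = space lborel"
    "\<forall>a\<in>A. emeasure lborel a \<noteq> \<infinity>"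
    using lborel.sigma_finite_countable by blast
  then show "\<exists>A::'a set set. countable A \<and> A \<subseteq> sets lebesgue \<and> \<Union>A = space lebesgue \<and>
      (\<forall>a\<in>A. emeasure lebesgue a \<noteq> \<infinity>)"
    by (intro exI[of _ A]) (auto intro: sets_completionI_sets)
qed

text \<open>\<open>u x * f x\<close> is the area of the rectangle with sides \<open>u x\<close> and
  \<open>f x\<close>; exchanging the order of integration turns areas into measures of joint
  superlevel sets.\<close>

lemma nn_integral_mult_layer_cake:
  fixes u f :: "'a \<Rightarrow> real"
  assumes M: "sigma_finite_measure M"
    and [measurable]: "u \<in> borel_measurable M" "f \<in> borel_measurable M"
    and nn: "\<And>x. 0 \<le> u x" "\<And>x. 0 \<le> f x"
  shows "(\<integral>\<^sup>+x. ennreal (u x * f x) \<partial>M) =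
    (\<integral>\<^sup>+z. emeasure M {x\<in>space M. (0 < fst z \<and> fst z < u x) \<and> (0 < snd z \<and> snd z < f x)}
      \<partial>(lborel \<Otimes>\<^sub>M lborel))"
proof -
  interpret M: sigma_finite_measure M by (rule M)
  interpret L: pair_sigma_finite "lborel :: real measure" "lborel :: real measure" ..
  interpret P: pair_sigma_finite M "lborel \<Otimes>\<^sub>M lborel :: (real \<times> real) measure" ..
  define F :: "'a \<times> (real \<times> real) \<Rightarrow> ennreal" where
    "F = (\<lambda>(x, z). indicator {p \<in> space (M \<Otimes>\<^sub>M (lborel \<Otimes>\<^sub>M lborel)).
        (0 < fst (snd p) \<and> fst (snd p) < u (fst p)) \<and> (0 < snd (snd p) \<and> snd (snd p) < f (fst p))} (x, z))"
  have [measurable]: "F \<in> borel_measurable (M \<Otimes>\<^sub>M (lborel \<Otimes>\<^sub>M lborel))"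
    unfolding F_def by measurable
  have "(\<integral>\<^sup>+x. ennreal (u x * f x) \<partial>M) = (\<integral>\<^sup>+x. (\<integral>\<^sup>+z. F (x, z) \<partial>(lborel \<Otimes>\<^sub>M lborel)) \<partial>M)"
  proof (intro nn_integral_cong)
    fix x assume x: "x \<in> space M"
    have "(\<integral>\<^sup>+z. F (x, z) \<partial>(lborel \<Otimes>\<^sub>M lborel))
        = (\<integral>\<^sup>+z. indicator ({0<..<u x} \<times> {0<..<f x}) z \<partial>(lborel \<Otimes>\<^sub>M lborel))"
      using x by (intro nn_integral_cong) (auto simp: F_def space_pair_measure split: split_indicator)
    also have "\<dots> = emeasure (lborel \<Otimes>\<^sub>M lborel) ({0<..<u x} \<times> {0<..<f x})"
      by (intro nn_integral_indicator) auto
    also have "\<dots> = ennreal (u x) * ennreal (f x)"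
      using nn by (subst lborel.emeasure_pair_measure_Times) auto
    finally show "ennreal (u x * f x) = (\<integral>\<^sup>+z. F (x, z) \<partial>(lborel \<Otimes>\<^sub>M lborel))"
      using nn by (simp add: ennreal_mult)
  qed
  also have "\<dots> = (\<integral>\<^sup>+z. (\<integral>\<^sup>+x. F (x, z) \<partial>M) \<partial>(lborel \<Otimes>\<^sub>M lborel))"
    by (rule P.Fubini[symmetric]) measurable
  also have "\<dots> = (\<integral>\<^sup>+z. emeasure M {x\<in>space M. (0 < fst z \<and> fst z < u x) \<and> (0 < snd z \<and> snd z < f x)}
      \<partial>(lborel \<Otimes>\<^sub>M lborel))"
  proof (intro nn_integral_cong)
    fix z :: "real \<times> real"
    have "(\<integral>\<^sup>+x. F (x, z) \<partial>M) = (\<integral>\<^sup>+x. indicator {x\<in>space M. (0 < fst z \<and> fst z < u x) \<and> (0 < snd z \<and> snd z < f x)} x \<partial>M)"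
      by (intro nn_integral_cong) (auto simp: F_def space_pair_measure split: split_indicator)
    then show "(\<integral>\<^sup>+x. F (x, z) \<partial>M) = emeasure M {x\<in>space M. (0 < fst z \<and> fst z < u x) \<and> (0 < snd z \<and> snd z < f x)}"
      by simp
  qed
  finally show ?thesis .
qed

text \<open>A form of the Hardy-Littlewood rearrangement inequality. A joint superlevel set of
  \<open>u\<close> and \<open>f\<close> is never larger than the smaller of the two separate ones;
  nested superlevel sets of \<open>h\<close> and \<open>g\<close> attain that minimum, and this is
  how the last hypothesis will be met.\<close>

lemma nn_integral_mult_mono_layers:
  fixes u f h g :: "'a \<Rightarrow> real"
  assumes M: "sigma_finite_measure M"
    and m[measurable]: "u \<in> borel_measurable M" "f \<in> borel_measurable M"
      "h \<in> borel_measurable M" "g \<in> borel_measurable M"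
    and nn: "\<And>x. 0 \<le> u x" "\<And>x. 0 \<le> f x" "\<And>x. 0 \<le> h x" "\<And>x. 0 \<le> g x"
    and le: "\<And>a b. 0 < a \<Longrightarrow> 0 < b \<Longrightarrow>
      min (emeasure M {x\<in>space M. a < u x}) (emeasure M {x\<in>space M. b < f x})
      \<le> emeasure M {x\<in>space M. a < h x \<and> b < g x}"
  shows "(\<integral>\<^sup>+x. ennreal (u x * f x) \<partial>M) \<le> (\<integral>\<^sup>+x. ennreal (h x * g x) \<partial>M)"
  unfolding nn_integral_mult_layer_cake[OF M m(1,2) nn(1,2)] nn_integral_mult_layer_cake[OF M m(3,4) nn(3,4)]
proof (intro nn_integral_mono)
  fix z :: "real \<times> real"
  show "emeasure M {x\<in>space M. (0 < fst z \<and> fst z < u x) \<and> (0 < snd z \<and> snd z < f x)}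
    \<le> emeasure M {x\<in>space M. (0 < fst z \<and> fst z < h x) \<and> (0 < snd z \<and> snd z < g x)}"
  proof (cases "0 < fst z \<and> 0 < snd z")
    case True
    have "emeasure M {x\<in>space M. (0 < fst z \<and> fst z < u x) \<and> (0 < snd z \<and> snd z < f x)}
        \<le> min (emeasure M {x\<in>space M. fst z < u x}) (emeasure M {x\<in>space M. snd z < f x})"
      by (intro min.boundedI emeasure_mono) auto
    also have "\<dots> \<le> emeasure M {x\<in>space M. fst z < h x \<and> snd z < g x}"
      using True by (intro le) auto
    finally show ?thesis using True by simp
  qed auto
qed

text \<open>The model function of condition (iii) at scale \<open>s\<close>.\<close>

definition decay :: "real \<Rightarrow> real \<Rightarrow> real \<Rightarrow> real" where
  "decay s \<mu> r = 1 / (1 + r / s) powr \<mu>"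

section \<open>Level sets of the model function\<close>

lemma decay_pos: "0 < s \<Longrightarrow> 0 \<le> r \<Longrightarrow> 0 < decay s \<mu> r"
  unfolding decay_def by (intro divide_pos_pos) (auto simp: add_pos_nonneg powr_gt_zero intro!: less_imp_neq[THEN not_sym])

lemma decay_less_iff:
  assumes "0 < s" "0 < \<mu>" "0 \<le> r" "0 \<le> m"
  shows "decay s \<mu> m < decay s \<mu> r \<longleftrightarrow> r < m"
proof -
  have "decay s \<mu> m < decay s \<mu> r \<longleftrightarrow> (1 + r / s) powr \<mu> < (1 + m / s) powr \<mu>"
  proof -
    have "0 < 1 + r / s" "0 < 1 + m / s" using assms by (auto intro!: add_pos_nonneg)
    then have "0 < (1 + r / s) powr \<mu>" "0 < (1 + m / s) powr \<mu>" by auto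
    then show ?thesis unfolding decay_def by (simp add: field_simps)
  qed
  also have "\<dots> \<longleftrightarrow> 1 + r / s < 1 + m / s"
    using assms powr_less_mono2[of \<mu> "1 + r / s" "1 + m / s"] powr_mono2[of \<mu> "1 + m / s" "1 + r / s"]
    by (smt (verit) divide_nonneg_pos)
  also have "\<dots> \<longleftrightarrow> r < m" using assms by (simp add: divide_less_cancel)
  finally show ?thesis .
qed

lemma distr_fun_ennreal:
  "0 \<le> b \<Longrightarrow> distr_fun M (\<lambda>x. ennreal (k x)) (ennreal b) = emeasure M {x\<in>space M. b < k x}"
  by (simp add: distr_fun_def ennreal_less_iff)

text \<open>Strict monotonicity of \<open>decay\<close> makes the superlevel set of the model the
  interval from \<open>0\<close> to \<open>m\<close>. Thus superlevel sets of
  \<open>\<bar>h\<bar>\<close> realise every finite measure and can be matched with those of another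
  function.\<close>

lemma emeasure_gt_decay:
  fixes h :: "'a::euclidean_space \<Rightarrow> real"
  assumes h: "distr_fun lebesgue (eabs h) = distr_fun (lebesgue_on {0<..}) (\<lambda>r. ennreal (decay s \<mu> r))"
    and s: "0 < s" "0 < \<mu>" and m: "0 \<le> m"
  shows "emeasure lebesgue {x. decay s \<mu> m < \<bar>h x\<bar>} = ennreal m"
proof -
  have d: "0 < decay s \<mu> m" using s(1) m by (rule decay_pos)
  have "emeasure lebesgue {x. decay s \<mu> m < \<bar>h x\<bar>} = distr_fun lebesgue (eabs h) (ennreal (decay s \<mu> m))"
    using d by (simp add: distr_fun_ennreal)
  also have "\<dots> = emeasure (lebesgue_on {0<..}) {r \<in> {0<..}. decay s \<mu> m < decay s \<mu> r}"
    unfolding h using d by (simp add: distr_fun_ennreal)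
  also have "{r \<in> {0<..}. decay s \<mu> m < decay s \<mu> r} = {0<..<m}"
    using decay_less_iff[OF s _ m] by auto
  also have "emeasure (lebesgue_on {0<..}) {0<..<m} = ennreal m"
    using m by (subst emeasure_restrict_space) auto
  finally show ?thesis .
qed

lemma quasi_banach_riD:
  assumes X: "quasi_banach_ri (X :: (real^'n \<Rightarrow> real) \<Rightarrow> ennreal)"
  shows quasi_banach_ri_eq_0_iff: "f \<in> borel_measurable lebesgue \<Longrightarrow> X f = 0 \<longleftrightarrow> (AE x in lebesgue. f x = 0)"
    and quasi_banach_ri_cmult: "f \<in> borel_measurable lebesgue \<Longrightarrow> X (\<lambda>x. c * f x) = ennreal \<bar>c\<bar> * X f"
    and quasi_banach_ri_mono: "f \<in> borel_measurable lebesgue \<Longrightarrow> g \<in> borel_measurable lebesgue \<Longrightarrow>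
       (AE x in lebesgue. \<bar>f x\<bar> \<le> \<bar>g x\<bar>) \<Longrightarrow> X f \<le> X g"
    and quasi_banach_ri_indicator: "E \<in> sets lebesgue \<Longrightarrow> emeasure lebesgue E < \<infinity> \<Longrightarrow> X (indicat_real E) < \<infinity>"
    and quasi_banach_ri_cong_distr: "f \<in> borel_measurable lebesgue \<Longrightarrow> g \<in> borel_measurable lebesgue \<Longrightarrow>
       distr_fun lebesgue (eabs f) = distr_fun lebesgue (eabs g) \<Longrightarrow> X f = X g"
    and quasi_banach_ri_triangle: "\<exists>K::real. \<forall>f\<in>borel_measurable lebesgue. \<forall>g\<in>borel_measurable lebesgue.
       X (\<lambda>x. f x + g x) \<le> ennreal K * (X f + X g)"
  using X unfolding quasi_banach_ri_def by blast+

text \<open>\<open>g\<close> rearranges \<open>f\<close> along the level sets of \<open>h\<close>: since \<open>\<bar>h\<bar>\<close> is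
  equimeasurable with a strictly decreasing function, \<open>\<sigma>\<close> below pushes Lebesgue measure on
  \<open>{h \<noteq> 0}\<close> forward to Lebesgue measure on the half-line, and \<open>g\<close> is the
  decreasing rearrangement of \<open>f\<close> composed with \<open>\<sigma>\<close>.\<close>

lemma rearrange_along:
  fixes h f :: "real^'n \<Rightarrow> real"
  assumes hm[measurable]: "h \<in> borel_measurable lebesgue"
    and h: "distr_fun lebesgue (eabs h) = distr_fun (lebesgue_on {0<..}) (\<lambda>r. ennreal (decay s \<mu> r))"
    and s: "0 < s" "0 < \<mu>"
    and fm[measurable]: "f \<in> borel_measurable lebesgue" and f: "\<And>x. \<bar>f x\<bar> \<le> k"
    and fin: "emeasure lebesgue {x. f x \<noteq> 0} < \<infinity>"
  obtains g where "g \<in> borel_measurable lebesgue" "\<And>x. 0 \<le> g x" "\<And>x. g x \<le> k"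
    "distr_fun lebesgue (eabs g) = distr_fun lebesgue (eabs f)"
    "\<And>b. 0 \<le> b \<Longrightarrow> \<exists>m. 0 \<le> m \<and> emeasure lebesgue {x. b < \<bar>f x\<bar>} = ennreal m \<and>
        (0 < m \<longrightarrow> {x. b < g x} = {x. decay s \<mu> m < \<bar>h x\<bar>})"
proof -
  have k: "0 \<le> k" using f[of undefined] abs_ge_zero order_trans by blast
  have efm[measurable]: "eabs f \<in> borel_measurable lebesgue" by measurable
  \<comment> \<open>For \<open>h x\<close> nonzero this solves
    \<open>decay s \<mu> r = \<bar>h x\<bar>\<close> for \<open>r\<close>; it is negative where
    \<open>\<bar>h x\<bar> > 1\<close>.\<close>
  define \<sigma> where "\<sigma> x = s * (\<bar>h x\<bar> powr (- 1 / \<mu>) - 1)" for x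
  define F where "F = rearr lebesgue (eabs f)"
  have Fk: "F r \<le> ennreal k" for r
  proof -
    have "{x. ennreal k < eabs f x} = {}" using f k by (auto simp: ennreal_less_iff not_less)
    then have "distr_fun lebesgue (eabs f) (ennreal k) = 0" by (simp add: distr_fun_def)
    then show ?thesis unfolding F_def rearr_def by (intro Inf_lower) simp
  qed
  \<comment> \<open>Where \<open>h\<close> vanishes the parameter should be infinite, beyond the
    measure of the support of \<open>f\<close>, so \<open>g\<close> is \<open>0\<close>. The
    convention \<open>0 powr a = 0\<close> would give a wrong \<open>\<sigma> x\<close>, hence the
    case distinction.\<close>
  define g where "g x = (if h x = 0 then 0 else enn2real (F (\<sigma> x)))" for x
  have lam: "distr_fun lebesgue (eabs f) (ennreal b) = emeasure lebesgue {x. b < \<bar>f x\<bar>}" if "0 \<le> b" for b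
    using that by (simp add: distr_fun_def ennreal_less_iff)
  have fin': "emeasure lebesgue {x. b < \<bar>f x\<bar>} < \<infinity>" if "0 \<le> b" for b
  proof -
    have "emeasure lebesgue {x. b < \<bar>f x\<bar>} \<le> emeasure lebesgue {x. f x \<noteq> 0}"
    proof (rule emeasure_mono)
      have "{x \<in> space lebesgue. f x \<noteq> 0} \<in> sets lebesgue" by measurable
      then show "{x. f x \<noteq> 0} \<in> sets lebesgue" by simp
    qed (use that in auto)
    then show ?thesis using fin by (rule le_less_trans)
  qed
  have level: "\<exists>m. 0 \<le> m \<and> emeasure lebesgue {x. b < \<bar>f x\<bar>} = ennreal m \<and>
        {x. b < g x} = (if 0 < m then {x. decay s \<mu> m < \<bar>h x\<bar>} else {})" if b: "0 \<le> b" for b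
  proof -
    obtain m where m: "0 \<le> m" "emeasure lebesgue {x. b < \<bar>f x\<bar>} = ennreal m"
      using fin'[OF b] by (cases "emeasure lebesgue {x. b < \<bar>f x\<bar>}") auto
    have iff: "b < g x \<longleftrightarrow> 0 < m \<and> decay s \<mu> m < \<bar>h x\<bar>" for x
    proof (cases "h x = 0")
      case True
      then show ?thesis using b decay_pos[OF s(1) m(1), of \<mu>] by (simp add: g_def)
    next
      case False
      have "F (\<sigma> x) < top" using Fk by (rule le_less_trans) simp
      then have "ennreal (g x) = F (\<sigma> x)" using False by (simp add: g_def)
      then have "b < g x \<longleftrightarrow> ennreal b < F (\<sigma> x)" using ennreal_less_iff[OF b, of "g x"] by simp
      also have "\<dots> \<longleftrightarrow> ennreal (\<sigma> x) < ennreal m"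
        unfolding F_def less_rearr_iff[OF efm] lam[OF b] m(2) ..
      \<comment> \<open>\<open>ennreal\<close> sends negative numbers to \<open>0\<close>, so for
        \<open>m = 0\<close> the left side is false even where \<open>\<sigma> x\<close> is
        negative; the conjunct \<open>0 < m\<close> records this.\<close>
      also have "\<dots> \<longleftrightarrow> 0 < m \<and> \<sigma> x < m"
        using m(1) by (cases "0 \<le> \<sigma> x") (auto simp: ennreal_less_iff ennreal_neg)
      also have "\<dots> \<longleftrightarrow> 0 < m \<and> decay s \<mu> m < \<bar>h x\<bar>"
      proof -
        have ms: "0 < 1 + m / s" using m s by (simp add: add_pos_nonneg)
        have "\<sigma> x < m \<longleftrightarrow> \<bar>h x\<bar> powr (- 1 / \<mu>) < 1 + m / s"
          using s by (simp add: \<sigma>_def field_simps)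
        also have "\<dots> \<longleftrightarrow> (1 + m / s) powr (- \<mu>) < \<bar>h x\<bar>"
        proof
          assume "\<bar>h x\<bar> powr (- 1 / \<mu>) < 1 + m / s"
          then have "(1 + m / s) powr (- \<mu>) < (\<bar>h x\<bar> powr (- 1 / \<mu>)) powr (- \<mu>)"
            using False s by (intro powr_less_mono2_neg) auto
          then show "(1 + m / s) powr (- \<mu>) < \<bar>h x\<bar>" using False s by (simp add: powr_powr)
        next
          assume "(1 + m / s) powr (- \<mu>) < \<bar>h x\<bar>"
          then have "\<bar>h x\<bar> powr (- 1 / \<mu>) < ((1 + m / s) powr (- \<mu>)) powr (- 1 / \<mu>)"
            using ms s by (intro powr_less_mono2_neg) auto
          then show "\<bar>h x\<bar> powr (- 1 / \<mu>) < 1 + m / s" using ms s by (simp add: powr_powr)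
        qed
        finally show ?thesis by (simp add: powr_minus_divide decay_def)
      qed
      finally show ?thesis .
    qed
    show ?thesis by (intro exI[of _ m]) (use m iff in auto)
  qed
  have g0: "0 \<le> g x" for x by (simp add: g_def)
  \<comment> \<open>At nonnegative heights a superlevel set of \<open>g\<close> is empty or a
    superlevel set of \<open>\<bar>h\<bar>\<close>; at negative heights it is the whole
    space.\<close>
  have gm: "g \<in> borel_measurable lebesgue"
  proof (rule borel_measurableI_greater)
    fix b :: real
    show "{x \<in> space lebesgue. b < g x} \<in> sets lebesgue"
    proof (cases "0 \<le> b")
      case True
      obtain m where "{x. b < g x} = (if 0 < m then {x. decay s \<mu> m < \<bar>h x\<bar>} else {})"
        using level[OF True] by blast
      moreover have "{x. decay s \<mu> m < \<bar>h x\<bar>} \<in> sets lebesgue"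
        by (intro lebesgue_Collect) measurable
      ultimately show ?thesis by simp
    next
      case False
      then have "{x. b < g x} = UNIV" using g0 by (auto simp: not_le intro: less_le_trans)
      then show ?thesis by simp
    qed
  qed
  have distr: "distr_fun lebesgue (eabs g) = distr_fun lebesgue (eabs f)"
  proof
    fix t :: ennreal
    show "distr_fun lebesgue (eabs g) t = distr_fun lebesgue (eabs f) t"
    proof (cases t)
      case (real b)
      obtain m where m: "0 \<le> m" "emeasure lebesgue {x. b < \<bar>f x\<bar>} = ennreal m"
        "{x. b < g x} = (if 0 < m then {x. decay s \<mu> m < \<bar>h x\<bar>} else {})"
        using level[OF real(1)] by blast
      have "distr_fun lebesgue (eabs g) t = emeasure lebesgue {x. b < g x}"
        using real g0 by (simp add: distr_fun_def ennreal_less_iff)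
      also have "\<dots> = ennreal m" using emeasure_gt_decay[OF h s m(1)] m by auto
      finally show ?thesis using lam[OF real(1)] m(2) real(2) by simp
    qed (simp add: distr_fun_def)
  qed
  have "g x \<le> k" for x
    using enn2real_mono[OF Fk[of "\<sigma> x"]] k by (simp add: g_def)
  moreover have "\<exists>m. 0 \<le> m \<and> emeasure lebesgue {x. b < \<bar>f x\<bar>} = ennreal m \<and>
        (0 < m \<longrightarrow> {x. b < g x} = {x. decay s \<mu> m < \<bar>h x\<bar>})" if b: "0 \<le> b" for b
    using level[OF b] by (metis (no_types, lifting))
  ultimately show ?thesis using that gm g0 distr by blast
qed

text \<open>\<open>h\<close> is tested not against \<open>f\<close> but against its rearrangement
  \<open>g\<close> along \<open>h\<close>, which has the same quasi-norm and whose superlevel sets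
  are nested with those of \<open>\<bar>h\<bar>\<close>. Boundedness and finite support of
  \<open>f\<close> make the test product integrable, as \<open>associate\<close> demands.\<close>

lemma Hoelder_associate_bounded:
  fixes X :: "(real^'n \<Rightarrow> real) \<Rightarrow> ennreal" and h f :: "real^'n \<Rightarrow> real"
  assumes X: "quasi_banach_ri X" and hm[measurable]: "h \<in> borel_measurable lebesgue"
    and h: "distr_fun lebesgue (eabs h) = distr_fun (lebesgue_on {0<..}) (\<lambda>r. ennreal (decay s \<mu> r))"
    and s: "0 < s" "0 < \<mu>"
    and um[measurable]: "u \<in> borel_measurable lebesgue" and u0: "\<And>x. 0 \<le> u x" and c: "0 < c"
    and le: "\<And>a. 0 < a \<Longrightarrow> emeasure lebesgue {x. a < u x} \<le> emeasure lebesgue {x. a < c * \<bar>h x\<bar>}"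
    and fm[measurable]: "f \<in> borel_measurable lebesgue" and f0: "\<And>x. 0 \<le> f x" and fk: "\<And>x. f x \<le> k"
    and fin: "emeasure lebesgue {x. f x \<noteq> 0} < \<infinity>"
    and A: "0 < A" "X f \<le> ennreal A"
  shows "(\<integral>\<^sup>+x. ennreal (u x * f x) \<partial>lebesgue) \<le> ennreal (c * A) * associate X h"
proof -
  have fabs: "\<bar>f x\<bar> \<le> k" for x using f0 fk by simp
  have k: "0 \<le> k" using f0 fk order_trans by blast
  obtain g where gm[measurable]: "g \<in> borel_measurable lebesgue" and g0: "\<And>x. 0 \<le> g x"
    and gk: "\<And>x. g x \<le> k" and gd: "distr_fun lebesgue (eabs g) = distr_fun lebesgue (eabs f)"
    and lev: "\<And>b. 0 \<le> b \<Longrightarrow> \<exists>m. 0 \<le> m \<and> emeasure lebesgue {x. b < \<bar>f x\<bar>} = ennreal m \<and>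
        (0 < m \<longrightarrow> {x. b < g x} = {x. decay s \<mu> m < \<bar>h x\<bar>})"
    using rearrange_along[OF hm h s fm fabs fin] by blast
  have "(\<integral>\<^sup>+x. ennreal (u x * f x) \<partial>lebesgue) \<le> (\<integral>\<^sup>+x. ennreal ((c * \<bar>h x\<bar>) * g x) \<partial>lebesgue)"
  proof (rule nn_integral_mult_mono_layers[OF sigma_finite_lebesgue])
    fix a b :: real assume ab: "0 < a" "0 < b"
    obtain m where m: "0 \<le> m" "emeasure lebesgue {x. b < f x} = ennreal m"
      "0 < m \<longrightarrow> {x. b < g x} = {x. decay s \<mu> m < \<bar>h x\<bar>}"
      using lev[of b] ab f0 by auto
    have "min (emeasure lebesgue {x. a < u x}) (emeasure lebesgue {x. b < f x})
        \<le> emeasure lebesgue {x. a < c * \<bar>h x\<bar> \<and> b < g x}"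
    proof (cases "m = 0")
      case False
      then have m0: "{x. b < g x} = {x. decay s \<mu> m < \<bar>h x\<bar>}" using m by simp
      have eq: "{x. a < c * \<bar>h x\<bar> \<and> b < g x} = {x. a / c < \<bar>h x\<bar>} \<inter> {x. decay s \<mu> m < \<bar>h x\<bar>}"
        unfolding m0[symmetric] using c by (auto simp: divide_less_eq mult.commute)
      show ?thesis
      \<comment> \<open>Both sets are superlevel sets of \<open>\<bar>h\<bar>\<close>, so their
        intersection is the one with the larger threshold.\<close>
      proof (cases "a / c \<le> decay s \<mu> m")
        case True
        then have "{x. a < c * \<bar>h x\<bar> \<and> b < g x} = {x. decay s \<mu> m < \<bar>h x\<bar>}"
          unfolding eq by (auto intro: le_less_trans)
        then have "emeasure lebesgue {x. a < c * \<bar>h x\<bar> \<and> b < g x} = emeasure lebesgue {x. b < f x}"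
          using emeasure_gt_decay[OF h s m(1)] m(2) by simp
        then show ?thesis by simp
      next
        case False
        then have "{x. a < c * \<bar>h x\<bar> \<and> b < g x} = {x. a / c < \<bar>h x\<bar>}"
          unfolding eq by (auto intro: less_trans)
        also have "\<dots> = {x. a < c * \<bar>h x\<bar>}"
          using c by (simp add: divide_less_eq mult.commute)
        finally show ?thesis using le[OF ab(1)] by (simp add: min.coboundedI1)
      qed
    qed (use m in simp)
    then show "min (emeasure lebesgue {x \<in> space lebesgue. a < u x}) (emeasure lebesgue {x \<in> space lebesgue. b < f x})
        \<le> emeasure lebesgue {x \<in> space lebesgue. a < c * \<bar>h x\<bar> \<and> b < g x}" by simp
  qed (use u0 f0 g0 c in auto)
  also have "\<dots> \<le> ennreal (c * A) * associate X h"
  proof -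
    \<comment> \<open>The sign of \<open>h\<close> makes the product \<open>h x * G x\<close>
      nonnegative, and \<open>1 / A\<close> brings the quasi-norm down to at most \<open>1\<close>,
      so \<open>G\<close> is admissible in the supremum.\<close>
    define G where "G x = (1 / A) * (sgn (h x) * g x)" for x
    have Gm[measurable]: "G \<in> borel_measurable lebesgue" unfolding G_def by measurable
    have "X G = ennreal \<bar>1 / A\<bar> * X (\<lambda>x. sgn (h x) * g x)"
      unfolding G_def by (intro quasi_banach_ri_cmult[OF X]) measurable
    also have "\<dots> \<le> ennreal \<bar>1 / A\<bar> * X g"
      by (intro mult_left_mono quasi_banach_ri_mono[OF X]) (auto simp: abs_mult sgn_if)
    also have "X g = X f" using gd by (intro quasi_banach_ri_cong_distr[OF X]) auto
    also have "ennreal \<bar>1 / A\<bar> * X f \<le> ennreal \<bar>1 / A\<bar> * ennreal A"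
      using A by (intro mult_left_mono) auto
    also have "\<dots> = 1" using A by (simp flip: ennreal_mult)
    finally have XG: "X G \<le> 1" .
    have hG: "h x * G x = \<bar>h x\<bar> * g x / A" for x
      by (simp add: G_def abs_sgn)
    have hG0: "0 \<le> h x * G x" for x using g0 A by (simp add: hG)
    \<comment> \<open>The model starts at height \<open>decay s \<mu> 0 = 1\<close>.\<close>
    have "emeasure lebesgue {x. 1 < \<bar>h x\<bar>} = 0" using emeasure_gt_decay[OF h s, of 0] by (simp add: decay_def)
    then have h1: "AE x in lebesgue. \<bar>h x\<bar> \<le> 1"
      by (subst AE_iff_measurable[of "{x. 1 < \<bar>h x\<bar>}"]) (auto simp: not_le intro!: lebesgue_Collect)
    obtain m where m: "emeasure lebesgue {x. 0 < g x} = ennreal m"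
    proof -
      have "emeasure lebesgue {x. 0 < g x} = distr_fun lebesgue (eabs g) 0"
        using g0 by (simp add: distr_fun_def)
      also have "\<dots> = emeasure lebesgue {x. f x \<noteq> 0}" unfolding gd by (simp add: distr_fun_def)
      finally show ?thesis using fin that by (cases "emeasure lebesgue {x. f x \<noteq> 0}") auto
    qed
    have fin': "(\<integral>\<^sup>+x. ennreal (h x * G x) \<partial>lebesgue) < \<infinity>"
    proof -
      have "(\<integral>\<^sup>+x. ennreal (h x * G x) \<partial>lebesgue)
          \<le> (\<integral>\<^sup>+x. ennreal (k / A) * indicator {x. 0 < g x} x \<partial>lebesgue)"
      proof (intro nn_integral_mono_AE)
        show "AE x in lebesgue. ennreal (h x * G x) \<le> ennreal (k / A) * indicator {x. 0 < g x} x"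
          using h1
        proof eventually_elim
          case (elim x)
          show ?case
          proof (cases "0 < g x")
            case True
            have "\<bar>h x\<bar> * g x \<le> 1 * k" using elim gk g0 by (intro mult_mono) auto
            then show ?thesis using A True by (simp add: hG ennreal_leI divide_right_mono)
          next
            case False
            then have "g x = 0" using g0[of x] by simp
            then show ?thesis by (simp add: hG)
          qed
        qed
      qed
      also have "\<dots> = ennreal (k / A) * ennreal m"
        unfolding m[symmetric] by (intro nn_integral_cmult_indicator lebesgue_Collect) measurable
      finally show ?thesis by (rule le_less_trans) (simp add: ennreal_mult_less_top)
    qed
    have int: "integrable lebesgue (\<lambda>x. h x * G x)"
      using fin' hG0 by (intro integrableI_nonneg) auto
    have "(\<integral>\<^sup>+x. ennreal (h x * G x) \<partial>lebesgue) = ennreal \<bar>LINT x|lebesgue. h x * G x\<bar>"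
      using nn_integral_eq_integral[OF int] hG0 by (simp add: integral_nonneg)
    also have "\<dots> \<le> associate X h"
      unfolding associate_def using XG int by (intro SUP_upper) auto
    finally have as: "(\<integral>\<^sup>+x. ennreal (h x * G x) \<partial>lebesgue) \<le> associate X h" .
    have "(\<integral>\<^sup>+x. ennreal ((c * \<bar>h x\<bar>) * g x) \<partial>lebesgue) = (\<integral>\<^sup>+x. ennreal (c * A) * ennreal (h x * G x) \<partial>lebesgue)"
    proof (intro nn_integral_cong)
      fix x
      have "(c * \<bar>h x\<bar>) * g x = (c * A) * (h x * G x)" using A by (simp add: hG)
      show "ennreal ((c * \<bar>h x\<bar>) * g x) = ennreal (c * A) * ennreal (h x * G x)"
        unfolding \<open>(c * \<bar>h x\<bar>) * g x = (c * A) * (h x * G x)\<close> using c A by (intro ennreal_mult hG0) simp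
    qed
    also have "\<dots> = ennreal (c * A) * (\<integral>\<^sup>+x. ennreal (h x * G x) \<partial>lebesgue)"
      by (intro nn_integral_cmult) measurable
    also have "\<dots> \<le> ennreal (c * A) * associate X h" using as by (intro mult_left_mono) auto
    finally show ?thesis .
  qed
  finally show ?thesis .
qed

text \<open>Truncation in height and in space leads to the bounded case, with
  \<open>X (F n) \<le> X f\<close> by the lattice property. The limit is taken only in the integral
  on the left, by monotone convergence.\<close>

lemma Hoelder_associate:
  fixes X :: "(real^'n \<Rightarrow> real) \<Rightarrow> ennreal" and h f :: "real^'n \<Rightarrow> real"
  assumes X: "quasi_banach_ri X" and hm[measurable]: "h \<in> borel_measurable lebesgue"
    and h: "distr_fun lebesgue (eabs h) = distr_fun (lebesgue_on {0<..}) (\<lambda>r. ennreal (decay s \<mu> r))"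
    and s: "0 < s" "0 < \<mu>"
    and um[measurable]: "u \<in> borel_measurable lebesgue" and u0: "\<And>x. 0 \<le> u x" and c: "0 < c"
    and le: "\<And>a. 0 < a \<Longrightarrow> emeasure lebesgue {x. a < u x} \<le> emeasure lebesgue {x. a < c * \<bar>h x\<bar>}"
    and fm[measurable]: "f \<in> borel_measurable lebesgue" and f0: "\<And>x. 0 \<le> f x"
    and A: "0 < A" "X f \<le> ennreal A"
  shows "(\<integral>\<^sup>+x. ennreal (u x * f x) \<partial>lebesgue) \<le> ennreal (c * A) * associate X h"
proof -
  define F where "F n x = min (f x) (real n) * indicat_real (cball 0 (real n)) x" for n x
  have [measurable]: "cball 0 (real n) \<in> sets lebesgue" for n by simp
  have Fm[measurable]: "F n \<in> borel_measurable lebesgue" for n unfolding F_def by measurable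
  have F0: "0 \<le> F n x" for n x using f0 by (simp add: F_def)
  have Ff: "F n x \<le> f x" for n x using f0[of x] by (simp add: F_def split: split_indicator)
  have inc: "F n x \<le> F m x" if "n \<le> m" for n m x
    using f0[of x] that by (auto simp: F_def split: split_indicator)
  have ev: "\<exists>n. F n x = f x" for x
  proof -
    obtain n :: nat where "max (f x) (norm x) \<le> real n" using real_arch_simple by blast
    then show ?thesis by (intro exI[of _ n]) (simp add: F_def min_absorb1)
  qed
  have bound: "(\<integral>\<^sup>+x. ennreal (u x * F n x) \<partial>lebesgue) \<le> ennreal (c * A) * associate X h" for n
  proof (rule Hoelder_associate_bounded[OF X hm h s um u0 c le Fm F0])
    show "F n x \<le> real n" for x by (simp add: F_def split: split_indicator)
    have "emeasure lebesgue {x. F n x \<noteq> 0} \<le> emeasure lebesgue (cball (0::real^'n) (real n))"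
      by (intro emeasure_mono) (auto simp: F_def split: split_indicator_asm)
    also have "\<dots> < \<infinity>" using emeasure_lborel_cball_finite[of "0::real^'n" "real n"] by simp
    finally show "emeasure lebesgue {x. F n x \<noteq> 0} < \<infinity>" .
    have "X (F n) \<le> X f" using F0 Ff f0 by (intro quasi_banach_ri_mono[OF X]) auto
    with A show "X (F n) \<le> ennreal A" by simp
  qed (use A in auto)
  have "(\<integral>\<^sup>+x. ennreal (u x * f x) \<partial>lebesgue) = (\<integral>\<^sup>+x. (SUP n. ennreal (u x * F n x)) \<partial>lebesgue)"
  proof (intro nn_integral_cong antisym)
    fix x
    obtain n where "F n x = f x" using ev by blast
    then show "ennreal (u x * f x) \<le> (SUP n. ennreal (u x * F n x))"
      by (intro SUP_upper2[of n]) auto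
    show "(SUP n. ennreal (u x * F n x)) \<le> ennreal (u x * f x)"
      using Ff u0 by (intro SUP_least ennreal_leI mult_left_mono) auto
  qed
  also have "\<dots> = (SUP n. \<integral>\<^sup>+x. ennreal (u x * F n x) \<partial>lebesgue)"
    using inc u0 by (intro nn_integral_monotone_convergence_SUP)
      (auto simp: incseq_def le_fun_def intro!: ennreal_leI mult_left_mono)
  also have "\<dots> \<le> ennreal (c * A) * associate X h" by (intro SUP_least bound)
  finally show ?thesis .
qed

section \<open>The fundamental function\<close>

lemma distr_fun_indicator:
  "E \<in> sets lebesgue \<Longrightarrow>
    distr_fun lebesgue (eabs (indicat_real E)) t = (if t < 1 then emeasure lebesgue E else 0)"
  unfolding distr_fun_def
  by (auto simp: indicator_def intro!: arg_cong[where f="emeasure lebesgue"] split: if_splits)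

lemma fundamental_eq:
  fixes X :: "(real^'n \<Rightarrow> real) \<Rightarrow> ennreal"
  assumes X: "quasi_banach_ri X" and E: "E \<in> sets lebesgue" "emeasure lebesgue E = ennreal t"
  shows "fundamental X t = X (indicat_real E)"
proof -
  have "X (indicat_real E') = X (indicat_real E)"
    if "E' \<in> sets lebesgue" "emeasure lebesgue E' = ennreal t" for E'
  proof (rule quasi_banach_ri_cong_distr[OF X])
    show "distr_fun lebesgue (eabs (indicat_real E')) = distr_fun lebesgue (eabs (indicat_real E))"
      by (rule ext) (simp only: distr_fun_indicator that E)
  qed (use that E in auto)
  then show ?thesis
    unfolding fundamental_def using E by (intro INF_eq_const) blast+
qed

text \<open>One concrete set for each measure. Anchoring all of them at the origin makes them
  nested, which gives monotonicity of the fundamental function.\<close>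

definition corner_cube :: "real \<Rightarrow> (real^'n) set" where
  "corner_cube t = cbox 0 (0 + vec (root CARD('n) t))"

lemma emeasure_corner_cube:
  "0 \<le> t \<Longrightarrow> emeasure lebesgue (corner_cube t :: (real^'n) set) = ennreal t"
  unfolding corner_cube_def using emeasure_cube[of "root CARD('n) t" "0 :: real^'n"] by simp

lemma corner_cube_sets [measurable]: "corner_cube t \<in> sets lebesgue"
  by (simp add: corner_cube_def)

lemma fundamental_mono:
  fixes X :: "(real^'n \<Rightarrow> real) \<Rightarrow> ennreal"
  assumes X: "quasi_banach_ri X" and st: "0 \<le> s" "s \<le> t"
  shows "fundamental X s \<le> fundamental X t"
proof -
  have r: "root CARD('n) s \<le> root CARD('n) t" using st by simp
  then have "corner_cube s \<subseteq> (corner_cube t :: (real^'n) set)"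
    by (simp add: corner_cube_def mem_box_cart subset_iff) (blast intro: order_trans[OF _ r])
  then have "X (indicat_real (corner_cube s)) \<le> X (indicat_real (corner_cube t))"
    by (intro quasi_banach_ri_mono[OF X]) (auto split: split_indicator)
  then show ?thesis
    using st by (simp add: fundamental_eq[OF X corner_cube_sets emeasure_corner_cube])
qed

lemma fundamental_pos_finite:
  fixes X :: "(real^'n \<Rightarrow> real) \<Rightarrow> ennreal"
  assumes X: "quasi_banach_ri X" and t: "0 < t"
  obtains c where "0 < c" "fundamental X t = ennreal c"
proof -
  let ?E = "corner_cube t :: (real^'n) set"
  have eq: "fundamental X t = X (indicat_real ?E)"
    using t by (intro fundamental_eq[OF X] emeasure_corner_cube) auto
  have "X (indicat_real ?E) < \<infinity>"
    by (rule quasi_banach_ri_indicator[OF X corner_cube_sets])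
      (simp only: emeasure_corner_cube[OF less_imp_le[OF t]] ennreal_less_top infinity_ennreal_def)
  moreover have "X (indicat_real ?E) \<noteq> 0"
  proof
    assume "X (indicat_real ?E) = 0"
    then have "AE x in lebesgue. indicat_real ?E x = 0"
      using quasi_banach_ri_eq_0_iff[OF X, of "indicat_real ?E"] by simp
    then have "AE x in lebesgue. x \<notin> ?E" by eventually_elim (auto split: split_indicator_asm)
    then have "emeasure lebesgue ?E = 0"
      using AE_iff_measurable[of ?E lebesgue "\<lambda>x. x \<notin> ?E"] by simp
    with t show False using emeasure_corner_cube[of t, where ?'n = 'n] by simp
  qed
  ultimately show ?thesis unfolding eq[symmetric]
    by (cases "fundamental X t") (auto simp: less_le intro: that)
qed

text \<open>Two disjoint cubes of measure \<open>s / 2\<close> form a set of measure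
  \<open>s\<close>, and the quasi-triangle inequality applies to their indicators. This pays for
  cutting a level set into two parts of which only one is known to exceed
  \<open>s / 2\<close>.\<close>

lemma fundamental_doubling:
  fixes X :: "(real^'n \<Rightarrow> real) \<Rightarrow> ennreal"
  assumes X: "quasi_banach_ri X" and s: "0 < s"
    and K: "\<forall>f\<in>borel_measurable lebesgue. \<forall>g\<in>borel_measurable lebesgue.
       X (\<lambda>x. f x + g x) \<le> ennreal K * (X f + X g)"
  shows "fundamental X s \<le> ennreal K * (fundamental X (s / 2) + fundamental X (s / 2))"
proof -
  define r where "r = root CARD('n) (s / 2)"
  have r: "0 < r" "r ^ CARD('n) = s / 2" using s by (auto simp: r_def)
  \<comment> \<open>The shift by \<open>2 * r\<close> leaves a gap, so the closed cubes are disjoint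
    and their indicators add up pointwise.\<close>
  define A B where "A = cbox 0 (0 + vec r :: real^'n)" and "B = cbox (vec (2 * r)) (vec (2 * r) + vec r :: real^'n)"
  have AB: "emeasure lebesgue A = ennreal (s / 2)" "emeasure lebesgue B = ennreal (s / 2)"
    using emeasure_cube[of r "0 :: real^'n"] emeasure_cube[of r "vec (2 * r) :: real^'n"] r
    by (auto simp: A_def B_def)
  have m[measurable]: "A \<in> sets lebesgue" "B \<in> sets lebesgue" by (auto simp: A_def B_def)
  have dis: "A \<inter> B = {}"
  proof -
    have False if "x \<in> A" "x \<in> B" for x
    proof -
      have "x $ undefined \<le> r" "2 * r \<le> x $ undefined"
        using that by (auto simp: A_def B_def mem_box_cart)
      then show False using r by simp
    qed
    then show ?thesis by blast
  qed
  have "emeasure lebesgue (A \<union> B) = emeasure lebesgue A + emeasure lebesgue B"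
    using dis m by (intro plus_emeasure[symmetric])
  also have "\<dots> = ennreal s" unfolding AB using s by (simp flip: ennreal_plus)
  finally have "fundamental X s = X (indicat_real (A \<union> B))"
    using m by (intro fundamental_eq[OF X]) auto
  also have "indicat_real (A \<union> B) = (\<lambda>x. indicat_real A x + indicat_real B x)"
    using dis by (intro ext) (auto split: split_indicator)
  also have "X \<dots> \<le> ennreal K * (X (indicat_real A) + X (indicat_real B))"
    using K by simp
  finally show ?thesis using fundamental_eq[OF X m(1) AB(1)] fundamental_eq[OF X m(2) AB(2)] by simp
qed

text \<open>The fundamental function is positive at \<open>s\<close>, so the rearrangement is finite
  there. Hence the set of infinite values lies in \<open>{x. t < Z x}\<close> for a finite
  \<open>t\<close> at which this set has measure at most \<open>s\<close>, and \<open>s\<close> is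
  arbitrary.\<close>

lemma AE_finite_Minf:
  fixes X :: "(real^'n \<Rightarrow> real) \<Rightarrow> ennreal"
  assumes X: "quasi_banach_ri X" and [measurable]: "Z \<in> borel_measurable lebesgue"
    and fin: "Minf_norm X Z < \<infinity>"
  shows "AE x in lebesgue. Z x < \<infinity>"
proof -
  have le: "emeasure lebesgue {x. Z x = \<infinity>} \<le> ennreal s" if s: "0 < s" for s
  proof -
    obtain c where c: "0 < c" "fundamental X s = ennreal c" by (rule fundamental_pos_finite[OF X s])
    have "fundamental X s * rearr lebesgue Z s \<le> Minf_norm X Z"
      unfolding Minf_norm_def using s by (intro SUP_upper) auto
    also note fin
    finally have "rearr lebesgue Z s < \<infinity>"
      using c by (cases "rearr lebesgue Z s = 0") (auto simp: ennreal_mult_less_top)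
    then obtain t where t: "distr_fun lebesgue Z t \<le> ennreal s" "t < \<infinity>"
      unfolding rearr_def Inf_less_iff by auto
    have "emeasure lebesgue {x. Z x = \<infinity>} \<le> emeasure lebesgue {x\<in>space lebesgue. t < Z x}"
      using t(2) by (intro emeasure_mono) (auto intro!: lebesgue_Collect)
    with t(1) show ?thesis by (simp add: distr_fun_def)
  qed
  have "emeasure lebesgue {x. Z x = \<infinity>} = 0"
  proof (rule ccontr)
    assume "emeasure lebesgue {x. Z x = \<infinity>} \<noteq> 0"
    moreover obtain m where m: "0 \<le> m" "emeasure lebesgue {x. Z x = \<infinity>} = ennreal m"
      using le[of 1] by (cases "emeasure lebesgue {x. Z x = \<infinity>}") (auto simp: top_unique)
    ultimately have "0 < m" by (cases "m = 0") auto
    then show False using le[of "m / 2"] m by (simp add: ennreal_le_iff)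
  qed
  moreover have "{x \<in> space lebesgue. Z x = \<infinity>} \<in> sets lebesgue" by measurable
  ultimately show ?thesis
    by (subst AE_iff_measurable[of "{x. Z x = \<infinity>}"]) (auto simp: not_less top_unique)
qed

section \<open>Maximal functions of powers and of indicators\<close>

lemma borel_measurable_maximal_pow[measurable]: "maximal_pow \<mu> f \<in> borel_measurable lebesgue"
  unfolding maximal_pow_def by measurable

lemma AE_le_maximal_pow:
  fixes f :: "real^'n \<Rightarrow> real"
  assumes [measurable]: "f \<in> borel_measurable lebesgue" and d: "0 < \<mu>"
  shows "AE x in lebesgue. eabs f x \<le> maximal_pow \<mu> f x"
proof -
  have "AE x in lebesgue. eabs (\<lambda>y. \<bar>f y\<bar> powr (1 / \<mu>)) x \<le> maximal (\<lambda>y. \<bar>f y\<bar> powr (1 / \<mu>)) x"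
    by (rule AE_le_maximal) measurable
  then show ?thesis
  proof eventually_elim
    case (elim x)
    have "eabs (\<lambda>y. \<bar>f y\<bar> powr (1 / \<mu>)) x epowr \<mu> \<le> maximal_pow \<mu> f x"
      unfolding maximal_pow_def using elim d by (intro epowr_mono) auto
    moreover have "eabs (\<lambda>y. \<bar>f y\<bar> powr (1 / \<mu>)) x epowr \<mu> = eabs f x"
      using d by (simp add: epowr_ennreal powr_powr)
    ultimately show ?case by simp
  qed
qed

lemma A1_weight_maximal_pow:
  assumes d: "0 < d" "d < 1"
  obtains C where "0 < C"
    "\<And>f :: real^'n \<Rightarrow> real. f \<in> borel_measurable lebesgue \<Longrightarrow> \<not> (AE x in lebesgue. f x = 0) \<Longrightarrow>
      (AE x in lebesgue. maximal_pow d f x < \<infinity>) \<Longrightarrow> A1_weight C (\<lambda>x. enn2real (maximal_pow d f x))"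
proof -
  obtain C where C: "0 < C"
    "\<And>h :: real^'n \<Rightarrow> real. h \<in> borel_measurable lebesgue \<Longrightarrow> \<not> (AE x in lebesgue. h x = 0) \<Longrightarrow>
      (AE x in lebesgue. maximal h x < \<infinity>) \<Longrightarrow> A1_weight C (\<lambda>x. enn2real (maximal h x epowr d))"
    using A1_weight_maximal[OF d, where ?'n = 'n] by blast
  have "A1_weight C (\<lambda>x. enn2real (maximal_pow d f x))"
    if [measurable]: "f \<in> borel_measurable lebesgue" and nz: "\<not> (AE x in lebesgue. f x = 0)"
      and fin: "AE x in lebesgue. maximal_pow d f x < \<infinity>" for f :: "real^'n \<Rightarrow> real"
    unfolding maximal_pow_def
  proof (rule C(2))
    show "AE x in lebesgue. maximal (\<lambda>y. \<bar>f y\<bar> powr (1 / d)) x < \<infinity>"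
      using fin
    proof eventually_elim
      case (elim x)
      then show ?case
        by (cases "maximal (\<lambda>y. \<bar>f y\<bar> powr (1 / d)) x") (auto simp: maximal_pow_def)
    qed
  qed (use nz in auto)
  with C(1) that show ?thesis by blast
qed

lemma maximal_indicator_le_1:
  fixes x :: "real^'n"
  shows "maximal (indicat_real F) x \<le> 1"
  unfolding maximal_def
proof (rule SUP_least)
  fix Q :: "(real^'n) set" assume "Q \<in> {Q \<in> cubes. x \<in> Q}"
  then have Q: "Q \<in> cubes" by simp
  have "(\<integral>\<^sup>+y\<in>Q. eabs (indicat_real F) y \<partial>lebesgue) \<le> (\<integral>\<^sup>+y. indicator Q y \<partial>lebesgue)"
    by (intro nn_integral_mono) (auto split: split_indicator)
  also have "\<dots> = emeasure lebesgue Q" using Q by (intro nn_integral_indicator cube_sets)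
  finally show "avg Q (eabs (indicat_real F)) \<le> 1" by (simp add: avg_le_iff[OF Q])
qed

lemma maximal_indicator_finite: "maximal (indicat_real F) x < \<infinity>"
  by (rule le_less_trans[OF maximal_indicator_le_1]) simp

lemma AE_maximal_indicator:
  fixes F :: "(real^'n) set"
  assumes [measurable]: "F \<in> sets lebesgue"
  shows "AE x in lebesgue. x \<in> F \<longrightarrow> maximal (indicat_real F) x = 1"
proof -
  have "AE x in lebesgue. eabs (indicat_real F) x \<le> maximal (indicat_real F) x"
    by (rule AE_le_maximal) measurable
  then show ?thesis
    by eventually_elim (auto intro!: antisym maximal_indicator_le_1)
qed

text \<open>\<open>(M \<chi>\<^sub>F)\<^sup>*\<close> decays like \<open>1 / t\<close> by the weak type inequality, so its \<open>\<mu>\<close>-th power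
  is dominated in distribution by a multiple of the model function at scale \<open>s = |F|\<close>.\<close>

lemma maximal_indicator_distr:
  fixes F :: "(real^'n) set" and h :: "real^'n \<Rightarrow> real"
  assumes F[measurable]: "F \<in> sets lebesgue" "emeasure lebesgue F = ennreal s" and s: "0 < s" "0 < \<mu>"
    and h: "distr_fun lebesgue (eabs h) = distr_fun (lebesgue_on {0<..}) (\<lambda>r. ennreal (decay s \<mu> r))"
    and a: "0 < a"
  defines "c \<equiv> ((10 * real CARD('n)) ^ CARD('n) + 1) powr \<mu>"
  shows "emeasure lebesgue {x. a < enn2real (maximal (indicat_real F) x epowr \<mu>)}
    \<le> emeasure lebesgue {x. a < c * \<bar>h x\<bar>}"
proof (cases "a < 1")
  case False
  have "enn2real (maximal (indicat_real F) x epowr \<mu>) \<le> 1" for x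
  proof -
    have "maximal (indicat_real F) x epowr \<mu> \<le> ennreal 1 epowr \<mu>"
      using maximal_indicator_le_1[of F x] s by (intro epowr_mono) auto
    also have "\<dots> = ennreal 1" by (subst epowr_ennreal) auto
    finally have "maximal (indicat_real F) x epowr \<mu> \<le> ennreal 1" .
    then show ?thesis using enn2real_leI[of 1] by simp
  qed
  then have "{x. a < enn2real (maximal (indicat_real F) x epowr \<mu>)} = {}" using False
    by (auto simp: not_less intro: order_trans)
  then show ?thesis by simp
next
  case True
  define W where "W = (10 * real CARD('n)) ^ CARD('n)"
  have W: "0 \<le> W" by (simp add: W_def)
  define b where "b = a powr (1 / \<mu>)"
  have b: "0 < b" "b \<le> 1" using a True s by (auto simp: b_def intro: powr_le1)
  have c: "0 < c" using W unfolding c_def W_def[symmetric] by simp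
  \<comment> \<open>\<open>m\<close> solves \<open>decay s \<mu> m = a / c\<close>. With
    \<open>W + 1\<close> instead of \<open>W\<close> inside \<open>c\<close>, and because
    \<open>b \<le> 1\<close>, it stays at least \<open>s * (W / b)\<close>, the bound from the weak
    type inequality.\<close>
  define m where "m = s * ((W + 1) / b - 1)"
  have b1: "1 \<le> 1 / b" using b by simp
  have "s * (W / b) \<le> s * (W / b + (1 / b - 1))" using b1 s by (intro mult_left_mono) auto
  also have "\<dots> = m" by (simp add: m_def add_divide_distrib algebra_simps)
  finally have mW: "s * (W / b) \<le> m" .
  then have m0: "0 \<le> m" using s W b by (meson divide_nonneg_pos mult_nonneg_nonneg less_imp_le order_trans)
  have "emeasure lebesgue {x. a < enn2real (maximal (indicat_real F) x epowr \<mu>)}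
      \<le> emeasure lebesgue {x. ennreal b < maximal (indicat_real F) x}"
  proof (rule emeasure_mono)
    show "{x. a < enn2real (maximal (indicat_real F) x epowr \<mu>)} \<subseteq> {x. ennreal b < maximal (indicat_real F) x}"
    proof (safe, rule ccontr)
      fix x assume x: "a < enn2real (maximal (indicat_real F) x epowr \<mu>)"
        and "\<not> ennreal b < maximal (indicat_real F) x"
      then have "maximal (indicat_real F) x epowr \<mu> \<le> ennreal b epowr \<mu>"
        using s by (intro epowr_mono) auto
      also have "\<dots> = ennreal a" using a s b by (simp add: epowr_ennreal b_def powr_powr)
      finally show False using x a enn2real_leI[of a] by fastforce
    qed
  qed measurable
  also have "\<dots> \<le> ennreal m"
  proof -
    have "(\<integral>\<^sup>+x. eabs (indicat_real F) x \<partial>lebesgue) = (\<integral>\<^sup>+x. indicator F x \<partial>lebesgue)"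
      by (intro nn_integral_cong) (auto split: split_indicator)
    also have "\<dots> = ennreal s" using F by simp
    finally have i: "(\<integral>\<^sup>+x. eabs (indicat_real F) x \<partial>lebesgue) = ennreal s" .
    have "ennreal b * emeasure lebesgue {x. ennreal b < maximal (indicat_real F) x} \<le> ennreal W * ennreal s"
      using weak_type_maximal[of "indicat_real F" b] b unfolding W_def[symmetric] i by simp
    also have "\<dots> = ennreal b * ennreal (s * (W / b))"
      using b s W by (simp add: mult.commute flip: ennreal_mult)
    also have "\<dots> \<le> ennreal b * ennreal m" using mW by (intro mult_left_mono ennreal_leI) auto
    finally show ?thesis using b by (simp add: ennreal_mult_le_mult_iff)
  qed
  also have "ennreal m = emeasure lebesgue {x. decay s \<mu> m < \<bar>h x\<bar>}"
    by (rule emeasure_gt_decay[OF h s m0, symmetric])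
  also have "decay s \<mu> m = a / c"
  proof -
    have "1 + m / s = (W + 1) / b" using s by (simp add: m_def)
    then have "(1 + m / s) powr \<mu> = (W + 1) powr \<mu> / b powr \<mu>" using W b by (simp add: powr_divide)
    also have "b powr \<mu> = a" using a s by (simp add: b_def powr_powr)
    finally show ?thesis by (simp add: decay_def c_def W_def)
  qed
  also have "{x. a / c < \<bar>h x\<bar>} = {x. a < c * \<bar>h x\<bar>}"
    using c by (simp add: divide_less_eq mult.commute)
  finally show ?thesis .
qed

text \<open>For finite \<open>I\<close> both sides are raised to the power \<open>p\<close>; an
  infinite \<open>I\<close> would make the left side of the hypothesis infinite and its right side
  is finite.\<close>

lemma epowr_root_le:
  assumes le: "ennreal y * I epowr (1 / p) \<le> ennreal B * ennreal j epowr (1 / p)"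
    and "0 < y" "0 \<le> B" "0 \<le> j" "1 \<le> p"
  shows "ennreal (y powr p) * I \<le> ennreal (B powr p * j)"
proof (cases I)
  case (real i)
  have "y * i powr (1 / p) \<le> B * j powr (1 / p)"
    using le assms real by (simp add: epowr_ennreal ennreal_le_iff flip: ennreal_mult)
  then have "(y * i powr (1 / p)) powr p \<le> (B * j powr (1 / p)) powr p"
    using assms by (intro powr_mono2) auto
  then have "y powr p * i \<le> B powr p * j"
    using assms real by (simp add: powr_mult powr_powr)
  then show ?thesis using real by (simp add: ennreal_leI flip: ennreal_mult)
next
  case top
  then have "ennreal y * I epowr (1 / p) = top" using assms by (simp add: ennreal_mult_top)
  moreover have "ennreal B * ennreal j epowr (1 / p) < top"
    using assms by (simp add: epowr_ennreal ennreal_mult_less_top)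
  ultimately show ?thesis using le by simp
qed

section \<open>Extrapolation\<close>

lemma indicator_not_AE_0:
  assumes [measurable]: "F \<in> sets M" and "emeasure M F \<noteq> 0"
  shows "\<not> (AE x in M. indicat_real F x = 0)"
proof
  assume "AE x in M. indicat_real F x = 0"
  then have "AE x in M. x \<notin> F" by eventually_elim (auto split: split_indicator_asm)
  then have "F \<in> null_sets M" by (subst AE_iff_null_sets) auto
  with assms show False by auto
qed

text \<open>\<open>rep_norm\<close> is an infimum, while the duality argument needs an actual
  function with the given profile. Doubling the bound creates the strict inequality from which such
  a function is extracted.\<close>

lemma exists_model_function:
  fixes X :: "(real^'n \<Rightarrow> real) \<Rightarrow> ennreal"
  assumes X: "quasi_banach_ri X"
    and i: "\<exists>C::real. \<forall>t>0. fundamental (associate X) t \<le> ennreal C * (ennreal t / fundamental X t)"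
    and iii: "\<exists>C::real. \<forall>s>0. rep_norm (associate X) (\<lambda>u. ennreal (1 / (1 + u / s) powr \<mu>))
         \<le> ennreal C * fundamental (associate X) s"
  obtains D where "0 < D" "\<And>s. 0 < s \<Longrightarrow> \<exists>h. h \<in> borel_measurable lebesgue \<and>
      distr_fun lebesgue (eabs h) = distr_fun (lebesgue_on {0<..}) (\<lambda>r. ennreal (decay s \<mu> r)) \<and>
      associate X h \<le> ennreal D * (ennreal s / fundamental X s)"
proof -
  obtain C1 :: real where C1: "\<And>t. 0 < t \<Longrightarrow> fundamental (associate X) t \<le> ennreal C1 * (ennreal t / fundamental X t)"
    using i by blast
  obtain C3 :: real where C3: "\<And>s. 0 < s \<Longrightarrow> rep_norm (associate X) (\<lambda>u. ennreal (1 / (1 + u / s) powr \<mu>))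
         \<le> ennreal C3 * fundamental (associate X) s" using iii by blast
  \<comment> \<open>Raising the constants to at least \<open>1\<close> makes the bound positive, so
    that its double is strictly larger.\<close>
  define E where "E = max 1 C3 * max 1 C1"
  have E: "0 < E" by (simp add: E_def)
  have "\<exists>h. h \<in> borel_measurable lebesgue \<and>
      distr_fun lebesgue (eabs h) = distr_fun (lebesgue_on {0<..}) (\<lambda>r. ennreal (decay s \<mu> r)) \<and>
      associate X h \<le> ennreal (2 * E) * (ennreal s / fundamental X s)" if s: "0 < s" for s
  proof -
    obtain c where c: "0 < c" "fundamental X s = ennreal c" by (rule fundamental_pos_finite[OF X s])
    have sc: "ennreal s / fundamental X s = ennreal (s / c)" using s c by (simp add: divide_ennreal)
    have "rep_norm (associate X) (\<lambda>u. ennreal (decay s \<mu> u)) \<le> ennreal C3 * (ennreal C1 * ennreal (s / c))"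
      unfolding decay_def using C3[OF s] C1[OF s, unfolded sc] by (meson mult_left_mono order_trans zero_le)
    also have "\<dots> \<le> ennreal (max 1 C3) * (ennreal (max 1 C1) * ennreal (s / c))"
      by (intro mult_mono ennreal_leI) auto
    also have "\<dots> = ennreal (E * (s / c))"
      using s c by (simp add: E_def mult.assoc flip: ennreal_mult)
    also have "\<dots> < ennreal (2 * E * (s / c))"
      using E s c by (intro ennreal_lessI mult_strict_right_mono) auto
    finally obtain h where "h \<in> borel_measurable lebesgue"
      "distr_fun lebesgue (eabs h) = distr_fun (lebesgue_on {0<..}) (\<lambda>r. ennreal (decay s \<mu> r))"
      "associate X h < ennreal (2 * E * (s / c))"
      unfolding rep_norm_def Inf_less_iff by auto
    moreover have "ennreal (2 * E * (s / c)) = ennreal (2 * E) * (ennreal s / fundamental X s)"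
      unfolding sc using E s c by (intro ennreal_mult) auto
    ultimately show ?thesis by (metis less_imp_le)
  qed
  with that[of "2 * E"] E show ?thesis by simp
qed

text \<open>The weight \<open>u1 * u2 powr (1 - p)\<close> turns the weak \<open>L\<^sup>p\<close> estimate into
  \<open>y |F| \<le> C \<integral> f u1\<close>, where \<open>u1 = 1\<close> on \<open>F\<close>; duality bounds the
  right-hand side by \<open>X f\<close> times \<open>|F| / fundamental X |F|\<close>.\<close>

lemma level_estimate:
  fixes X :: "(real^'n \<Rightarrow> real) \<Rightarrow> ennreal" and f g u2 :: "real^'n \<Rightarrow> real"
  assumes X: "quasi_banach_ri X" and p: "1 \<le> p" and mu: "0 < \<mu>" and D: "0 < D"
    and hm: "h \<in> borel_measurable lebesgue"
    and h: "distr_fun lebesgue (eabs h) = distr_fun (lebesgue_on {0<..}) (\<lambda>r. ennreal (decay s \<mu> r))"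
    and hX: "associate X h \<le> ennreal D * (ennreal s / fundamental X s)"
    and C: "0 < C1" "0 < C2"
    and u1: "A1_weight C1 (\<lambda>x. enn2real (maximal (indicat_real F) x epowr \<mu>))"
    and u2: "A1_weight C2 u2"
    and fm[measurable]: "f \<in> borel_measurable lebesgue" and f0: "\<And>x. 0 \<le> f x"
    and fu2: "AE x in lebesgue. f x \<le> u2 x"
    and A: "0 < A" "X f \<le> ennreal A"
    and B: "0 \<le> B"
    and hyp: "\<And>w. w \<in> Ap_class p \<Longrightarrow> Ap_const p w \<le> ennreal (C1 * C2 powr (p - 1)) \<Longrightarrow>
      weak_Lp_norm p w g \<le> ennreal B * Lp_norm p w f"
    and gm[measurable]: "g \<in> borel_measurable lebesgue"
    and y: "0 < y" and F[measurable]: "F \<in> sets lebesgue" and Fsub: "F \<subseteq> {x. y < \<bar>g x\<bar> \<and> u2 x \<le> y}"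
    and Fs: "emeasure lebesgue F = ennreal s" and s: "0 < s"
  shows "ennreal y * fundamental X s \<le> ennreal (B powr p * (((10 * real CARD('n)) ^ CARD('n) + 1) powr \<mu> * A * D))"
proof -
  define c where "c = ((10 * real CARD('n)) ^ CARD('n) + 1) powr \<mu>"
  have c: "0 < c"
  proof -
    have "0 < (10 * real CARD('n)) ^ CARD('n) + 1" by (intro add_nonneg_pos zero_le_power) auto
    then show ?thesis unfolding c_def by (metis powr_gt_zero less_irrefl)
  qed
  obtain fs where fs: "0 < fs" "fundamental X s = ennreal fs" by (rule fundamental_pos_finite[OF X s])
  define u1' where "u1' x = enn2real (maximal (indicat_real F) x epowr \<mu>)" for x
  have u1': "A1_weight C1 u1'" using u1 by (simp add: u1'_def[abs_def])
  have u1m[measurable]: "u1' \<in> borel_measurable lebesgue" and u1pos: "AE x in lebesgue. 0 < u1' x"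
    using u1' by (auto simp: A1_weight_def)
  have u2m[measurable]: "u2 \<in> borel_measurable lebesgue" and u2pos: "AE x in lebesgue. 0 < u2 x"
    using u2 by (auto simp: A1_weight_def)
  define w where "w x = u1' x * u2 x powr (1 - p)" for x
  have w: "weight w" "Ap_const p w \<le> ennreal (C1 * C2 powr (p - 1))"
    using A1_factorization[OF p u1' u2 C] by (simp_all add: w_def[abs_def])
  have wm[measurable]: "w \<in> borel_measurable lebesgue" unfolding w_def by measurable
  have "w \<in> Ap_class p"
    using w le_less_trans[OF w(2), of top] by (simp add: Ap_class_def)
  with w have weak: "weak_Lp_norm p w g \<le> ennreal B * Lp_norm p w f" by (intro hyp)
  define I where "I = (\<integral>\<^sup>+x\<in>{x. y < \<bar>g x\<bar>}. ennreal (w x) \<partial>lebesgue)"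
  \<comment> \<open>A finite bound for the weighted integral of \<open>f powr p\<close>:
    \<open>c * A\<close> comes from duality, the rest from the model function.\<close>
  define j where "j = c * A * (D * (s / fs))"
  have j: "0 \<le> j" using c A D s fs by (simp add: j_def)
  have "(\<integral>\<^sup>+x. ennreal (\<bar>f x\<bar> powr p) * ennreal (w x) \<partial>lebesgue) \<le> (\<integral>\<^sup>+x. ennreal (u1' x * f x) \<partial>lebesgue)"
  proof (rule nn_integral_mono_AE)
    show "AE x in lebesgue. ennreal (\<bar>f x\<bar> powr p) * ennreal (w x) \<le> ennreal (u1' x * f x)"
      using u1pos u2pos fu2
    proof eventually_elim
      case (elim x)
      have "\<bar>f x\<bar> powr p * w x \<le> u1' x * f x"
      proof (cases "f x = 0")
        case False
        then have fx: "0 < f x" using f0[of x] by simp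
        \<comment> \<open>The exponent is nonpositive and \<open>f x \<le> u2 x\<close>; positivity
          of \<open>f x\<close> keeps the convention \<open>0 powr a = 0\<close> out of the
          comparison.\<close>
        have "u2 x powr (1 - p) \<le> f x powr (1 - p)"
          using p fx elim by (intro powr_mono2') auto
        then have "f x powr p * u2 x powr (1 - p) \<le> f x powr p * f x powr (1 - p)"
          by (intro mult_left_mono) auto
        also have "\<dots> = f x" using fx by (simp flip: powr_add)
        finally have "u1' x * (f x powr p * u2 x powr (1 - p)) \<le> u1' x * f x"
          using elim by (intro mult_left_mono) auto
        then show ?thesis using fx by (simp add: w_def mult_ac)
      qed simp
      then have "ennreal (\<bar>f x\<bar> powr p * w x) \<le> ennreal (u1' x * f x)" by (rule ennreal_leI)
      then show ?case by (simp add: ennreal_mult')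
    qed
  qed
  also have "\<dots> \<le> ennreal (c * A) * associate X h"
  proof (rule Hoelder_associate[OF X hm h s mu u1m _ c _ fm f0 A])
    show "emeasure lebesgue {x. a < u1' x} \<le> emeasure lebesgue {x. a < c * \<bar>h x\<bar>}" if "0 < a" for a
      unfolding c_def u1'_def by (rule maximal_indicator_distr[OF F Fs s mu h that])
  qed (simp add: u1'_def)
  also have "\<dots> \<le> ennreal (c * A) * (ennreal D * (ennreal s / fundamental X s))"
    using hX by (rule mult_left_mono) simp
  also have "\<dots> = ennreal (c * A) * ennreal (D * (s / fs))"
  proof -
    have "ennreal s / fundamental X s = ennreal (s / fs)" using fs s by (simp add: divide_ennreal)
    moreover have "ennreal D * ennreal (s / fs) = ennreal (D * (s / fs))"
      using D fs s by (intro ennreal_mult[symmetric]) auto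
    ultimately show ?thesis by (simp only:)
  qed
  also have "\<dots> = ennreal j" unfolding j_def using c A D s fs by (intro ennreal_mult[symmetric]) auto
  finally have J: "(\<integral>\<^sup>+x. ennreal (\<bar>f x\<bar> powr p) * ennreal (w x) \<partial>lebesgue) \<le> ennreal j" .
  have "ennreal y * I epowr (1 / p) \<le> weak_Lp_norm p w g"
    unfolding weak_Lp_norm_def I_def using y by (intro SUP_upper) simp
  also note weak
  also have "ennreal B * Lp_norm p w f \<le> ennreal B * ennreal j epowr (1 / p)"
    unfolding Lp_norm_def using J p by (intro mult_left_mono epowr_mono) auto
  finally have I: "ennreal (y powr p) * I \<le> ennreal (B powr p * j)"
    using y B j p by (rule epowr_root_le)
  have "ennreal (y powr (1 - p)) * ennreal s = (\<integral>\<^sup>+x. ennreal (y powr (1 - p)) * indicator F x \<partial>lebesgue)"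
    unfolding Fs[symmetric] by (rule nn_integral_cmult_indicator[symmetric]) measurable
  also have "\<dots> \<le> I"
    unfolding I_def
  proof (rule nn_integral_mono_AE)
    show "AE x in lebesgue. ennreal (y powr (1 - p)) * indicator F x
        \<le> ennreal (w x) * indicator {x. y < \<bar>g x\<bar>} x"
      using AE_maximal_indicator[OF F] u2pos
    proof eventually_elim
      case (elim x)
      show ?case
      proof (cases "x \<in> F")
        case True
        \<comment> \<open>On \<open>F\<close> the first factor of the weight is \<open>1\<close>
          almost everywhere, so a lower bound for \<open>w\<close> only needs the upper bound
          \<open>y\<close> for \<open>u2\<close>.\<close>
        then have "u1' x = enn2real (ennreal 1 epowr \<mu>)" using elim by (simp add: u1'_def)
        then have "u1' x = 1" by (subst (asm) epowr_ennreal) auto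
        moreover have "y powr (1 - p) \<le> u2 x powr (1 - p)"
          using True Fsub elim p by (intro powr_mono2') auto
        ultimately show ?thesis using True Fsub by (auto simp: w_def intro!: ennreal_leI)
      qed simp
    qed
  qed
  finally have "ennreal (y powr p) * (ennreal (y powr (1 - p)) * ennreal s) \<le> ennreal (y powr p) * I"
    by (rule mult_left_mono) simp
  also note I
  also have "ennreal (y powr p) * (ennreal (y powr (1 - p)) * ennreal s) = ennreal (y powr p * (y powr (1 - p) * s))"
    using s by (simp add: ennreal_mult)
  also have "y powr p * (y powr (1 - p) * s) = y * s"
    using y by (simp add: mult.assoc[symmetric] powr_add[symmetric])
  finally have "y * s \<le> B powr p * j" using j by (simp add: ennreal_le_iff)
  \<comment> \<open>\<open>j\<close> carries the factor \<open>s / fs\<close>; cancelling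
    \<open>s\<close> leaves the fundamental function on the left.\<close>
  also have "\<dots> = (B powr p * (c * A * D) / fs) * s" by (simp add: j_def)
  finally have "y \<le> B powr p * (c * A * D) / fs" using s by (simp only: mult_le_cancel_right_pos)
  then have "y * fs \<le> B powr p * (c * A * D)" using fs by (simp add: field_simps)
  then show ?thesis
    unfolding c_def[symmetric] fs(2) using y fs by (simp add: ennreal_leI flip: ennreal_mult)
qed

text \<open>A single A_p weight suffices: for it the right side of the weak type bound is zero, and
  as it is positive almost everywhere, \<open>g\<close> vanishes almost everywhere.\<close>

lemma Minf_norm_eq_0:
  fixes X :: "(real^'n \<Rightarrow> real) \<Rightarrow> ennreal" and g :: "real^'n \<Rightarrow> real" and \<mu> p :: real
  assumes mu: "0 < \<mu>" "\<mu> < 1" and p: "1 \<le> p"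
    and f: "AE x in lebesgue. f x = 0" and [measurable]: "g \<in> borel_measurable lebesgue"
    and hyp: "\<And>w. w \<in> Ap_class p \<Longrightarrow> \<exists>B::real. weak_Lp_norm p w g \<le> ennreal B * Lp_norm p w f"
  shows "Minf_norm X (eabs g) = 0"
proof -
  obtain C where C: "0 < C"
    "\<And>h :: real^'n \<Rightarrow> real. h \<in> borel_measurable lebesgue \<Longrightarrow> \<not> (AE x in lebesgue. h x = 0) \<Longrightarrow>
      (AE x in lebesgue. maximal h x < \<infinity>) \<Longrightarrow> A1_weight C (\<lambda>x. enn2real (maximal h x epowr \<mu>))"
    using A1_weight_maximal[OF mu, where ?'n = 'n] by blast
  let ?F = "corner_cube 1 :: (real^'n) set"
  have "A1_weight C (\<lambda>x. enn2real (maximal (indicat_real ?F) x epowr \<mu>))"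
  proof (rule C(2))
    show "AE x in lebesgue. maximal (indicat_real ?F) x < \<infinity>"
      by (intro AE_I2 maximal_indicator_finite)
    have "emeasure lebesgue ?F \<noteq> 0"
      using emeasure_corner_cube[of 1, where ?'n = 'n] by (metis ennreal_1 zero_le_one zero_neq_one)
    then show "\<not> (AE x in lebesgue. indicat_real ?F x = 0)" by (rule indicator_not_AE_0[OF corner_cube_sets])
  qed measurable
  then obtain u :: "real^'n \<Rightarrow> real" where u: "A1_weight C u" by blast
  \<comment> \<open>The factorization lemma with two copies of one A_1 weight exhibits a member of
    \<open>Ap_class p\<close>.\<close>
  define w where "w x = u x * u x powr (1 - p)" for x
  have w: "weight w" "Ap_const p w \<le> ennreal (C * C powr (p - 1))"
    using A1_factorization[OF p u u C(1) C(1)] by (simp_all add: w_def[abs_def])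
  have wm[measurable]: "w \<in> borel_measurable lebesgue" and wpos: "AE x in lebesgue. 0 < w x"
    using w(1) by (auto simp: weight_def)
  have "w \<in> Ap_class p"
    using w le_less_trans[OF w(2), of top] by (simp add: Ap_class_def)
  then obtain B :: real where weak: "weak_Lp_norm p w g \<le> ennreal B * Lp_norm p w f" using hyp by blast
  have "(\<integral>\<^sup>+x. ennreal (\<bar>f x\<bar> powr p) * ennreal (w x) \<partial>lebesgue) = (\<integral>\<^sup>+(x :: real^'n). 0 \<partial>lebesgue)"
    using f by (intro nn_integral_cong_AE) (auto elim!: eventually_mono)
  then have "Lp_norm p w f = 0" by (simp add: Lp_norm_def epowr_def)
  then have "weak_Lp_norm p w g \<le> 0" using weak by simp
  have null: "distr_fun lebesgue (eabs g) (ennreal y) = 0" if y: "0 < y" for y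
  proof -
    define I where "I = (\<integral>\<^sup>+x\<in>{x. y < \<bar>g x\<bar>}. ennreal (w x) \<partial>lebesgue)"
    have "ennreal y * I epowr (1 / p) \<le> weak_Lp_norm p w g"
      unfolding weak_Lp_norm_def I_def using y by (intro SUP_upper) simp
    then have "I epowr (1 / p) = 0" using \<open>weak_Lp_norm p w g \<le> 0\<close> y by simp
    then have "I = 0" by (cases I) (auto simp: epowr_ennreal)
    have [measurable]: "{x. y < \<bar>g x\<bar>} \<in> sets lebesgue" by (intro lebesgue_Collect) measurable
    have "AE x in lebesgue. ennreal (w x) * indicator {x. y < \<bar>g x\<bar>} x = 0"
      using \<open>I = 0\<close> unfolding I_def by (subst (asm) nn_integral_0_iff_AE) measurable
    with wpos have "AE x in lebesgue. x \<notin> {x. y < \<bar>g x\<bar>}"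
      by eventually_elim (auto split: split_indicator_asm)
    then have "emeasure lebesgue {x. y < \<bar>g x\<bar>} = 0"
      by (subst (asm) AE_iff_null_sets[symmetric]) auto
    then show ?thesis using y by (simp add: distr_fun_ennreal)
  qed
  have "rearr lebesgue (eabs g) s = 0" for s
  proof (rule ccontr)
    assume "rearr lebesgue (eabs g) s \<noteq> 0"
    then have "0 < rearr lebesgue (eabs g) s" by (simp add: less_le)
    then obtain r :: rat where r: "0 < ennreal (real_of_rat r)" "ennreal (real_of_rat r) < rearr lebesgue (eabs g) s"
      using ennreal_rat_dense by (metis)
    then have "rearr lebesgue (eabs g) s \<le> ennreal (real_of_rat r)"
      unfolding rearr_def by (intro Inf_lower) (simp add: null)
    with r show False by simp
  qed
  then show ?thesis by (simp add: Minf_norm_def)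
qed

text \<open>A superlevel set of \<open>g\<close> may have infinite measure, but the set on which the
  weight is built must have finite measure; a large ball cuts it down without losing the lower bound
  \<open>s\<close>.\<close>

lemma emeasure_cball_Int_gt:
  fixes E :: "'a::euclidean_space set"
  assumes [measurable]: "E \<in> sets lebesgue" and "s < emeasure lebesgue E"
  obtains n :: nat where "s < emeasure lebesgue (E \<inter> cball 0 (real n))"
proof -
  have "(SUP n. emeasure lebesgue (E \<inter> cball 0 (real n))) = emeasure lebesgue (\<Union>n. E \<inter> cball 0 (real n))"
  proof (rule SUP_emeasure_incseq)
    show "incseq (\<lambda>n. E \<inter> cball 0 (real n))"
      unfolding incseq_def by (intro allI impI Int_mono subset_cball) auto
    show "range (\<lambda>n. E \<inter> cball 0 (real n)) \<subseteq> sets lebesgue" using assms(1) by auto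
  qed
  also have "(\<Union>n. E \<inter> cball 0 (real n)) = E"
    using real_arch_simple by auto
  finally have "s < (SUP n. emeasure lebesgue (E \<inter> cball 0 (real n)))" using assms(2) by (simp only:)
  then show ?thesis unfolding less_SUP_iff using that by blast
qed

theorem theorem3p21:
  fixes X :: "(real^'n \<Rightarrow> real) \<Rightarrow> ennreal" and \<phi> :: "real \<Rightarrow> real" and p\<^sub>0 :: real
  assumes X: "quasi_banach_ri X"
    and i: "\<exists>C::real. \<forall>t>0. fundamental (associate X) t \<le> ennreal C * (ennreal t / fundamental X t)"
    and ii: "\<exists>\<delta>. 0 < \<delta> \<and> \<delta> < 1 \<and>
      (\<exists>C::real. \<forall>f\<in>borel_measurable lebesgue. X f < \<infinity> \<longrightarrow>
         Minf_norm X (maximal_pow \<delta> f) \<le> ennreal C * X f)"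
    and iii: "\<exists>\<mu>. 0 < \<mu> \<and> \<mu> < 1 \<and>
      (\<exists>C::real. \<forall>s>0. rep_norm (associate X) (\<lambda>u. ennreal (1 / (1 + u / s) powr \<mu>))
         \<le> ennreal C * fundamental (associate X) s)"
    and p0: "1 \<le> p\<^sub>0"
    and phi: "locally_bounded \<phi>"
  shows "\<exists>C'>0. \<forall>f g.
    f \<in> borel_measurable lebesgue \<and> (\<forall>x. 0 \<le> f x) \<and>
    g \<in> borel_measurable lebesgue \<and> (\<forall>x. 0 \<le> g x) \<and>
    (\<forall>w\<in>Ap_class p\<^sub>0.
       weak_Lp_norm p\<^sub>0 w g \<le> ennreal (\<phi> (enn2real (Ap_const p\<^sub>0 w))) * Lp_norm p\<^sub>0 w f)
    \<longrightarrow> Minf_norm X (eabs g) \<le> ennreal C' * X f"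
proof -
  obtain \<delta> C\<^sub>M :: real where \<delta>: "0 < \<delta>" "\<delta> < 1" and M: "\<And>f. f \<in> borel_measurable lebesgue \<Longrightarrow>
      X f < \<infinity> \<Longrightarrow> Minf_norm X (maximal_pow \<delta> f) \<le> ennreal C\<^sub>M * X f"
    using ii by blast
  obtain \<mu> :: real where \<mu>: "0 < \<mu>" "\<mu> < 1" and iii': "\<exists>C::real. \<forall>s>0.
      rep_norm (associate X) (\<lambda>u. ennreal (1 / (1 + u / s) powr \<mu>)) \<le> ennreal C * fundamental (associate X) s"
    using iii by blast
  obtain D where D: "0 < D" and model: "\<And>s. 0 < s \<Longrightarrow> \<exists>h. h \<in> borel_measurable lebesgue \<and>
      distr_fun lebesgue (eabs h) = distr_fun (lebesgue_on {0<..}) (\<lambda>r. ennreal (decay s \<mu> r)) \<and>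
      associate X h \<le> ennreal D * (ennreal s / fundamental X s)"
    using exists_model_function[OF X i iii'] by blast
  obtain K where K: "\<forall>f\<in>borel_measurable lebesgue. \<forall>g\<in>borel_measurable lebesgue.
       X (\<lambda>x. f x + g x) \<le> ennreal K * (X f + X g)"
    using quasi_banach_ri_triangle[OF X] by blast
  obtain C1 where C1: "0 < C1" and A1_1:
    "\<And>h :: real^'n \<Rightarrow> real. h \<in> borel_measurable lebesgue \<Longrightarrow> \<not> (AE x in lebesgue. h x = 0) \<Longrightarrow>
      (AE x in lebesgue. maximal h x < \<infinity>) \<Longrightarrow> A1_weight C1 (\<lambda>x. enn2real (maximal h x epowr \<mu>))"
    using A1_weight_maximal[OF \<mu>, where ?'n = 'n] by blast
  obtain C2 where C2: "0 < C2" and A1_2: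
    "\<And>f :: real^'n \<Rightarrow> real. f \<in> borel_measurable lebesgue \<Longrightarrow> \<not> (AE x in lebesgue. f x = 0) \<Longrightarrow>
      (AE x in lebesgue. maximal_pow \<delta> f x < \<infinity>) \<Longrightarrow> A1_weight C2 (\<lambda>x. enn2real (maximal_pow \<delta> f x))"
    using A1_weight_maximal_pow[OF \<delta>, where ?'n = 'n] by blast
  define N where "N = C1 * C2 powr (p\<^sub>0 - 1)"
  have N: "0 < N" using C1 C2 by (simp add: N_def)
  have "bdd_above (\<phi> ` {0<..<N + 1})" using phi N by (simp add: locally_bounded_def)
  then obtain b where "\<forall>t\<in>{0<..<N + 1}. \<phi> t \<le> b"
    unfolding bdd_above_def by auto
  then have b: "\<phi> t \<le> b" if "0 < t" "t < N + 1" for t using that by simp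
  \<comment> \<open>Local boundedness controls \<open>\<phi>\<close> at positive arguments, while
    \<open>enn2real\<close> of the A_p constant is only known to lie between \<open>0\<close> and
    \<open>N\<close>; hence \<open>\<phi> 0\<close> is included separately.\<close>
  define B where "B = max 0 (max b (\<phi> 0))"
  have B: "0 \<le> B" by (simp add: B_def)
  have \<phi>_le: "\<phi> t \<le> B" if "0 \<le> t" "t \<le> N" for t
    using b[of t] that by (cases "t = 0") (auto simp: B_def)
  \<comment> \<open>\<open>L\<close> dominates both alternatives for half of a level set: the
    constant of (ii), and the bound of \<open>level_estimate\<close> with the factor
    \<open>A\<close> removed.\<close>
  define L where "L = max 0 C\<^sub>M + B powr p\<^sub>0 * (((10 * real CARD('n)) ^ CARD('n) + 1) powr \<mu> * D)"
  have L: "max 0 C\<^sub>M \<le> L" "B powr p\<^sub>0 * (((10 * real CARD('n)) ^ CARD('n) + 1) powr \<mu> * D) \<le> L"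
    using D by (auto simp: L_def)
  then have L0: "0 \<le> L" by simp
  \<comment> \<open>\<open>K\<close> and the factor \<open>2\<close> come from doubling; the added
    \<open>1\<close> makes the constant positive, so that an infinite \<open>X f\<close> gives an
    infinite right-hand side.\<close>
  define C' where "C' = max 0 K * (2 * L) + 1"
  have C': "0 < C'" using L0 by (simp add: C'_def add_nonneg_pos)
  have "Minf_norm X (eabs g) \<le> ennreal C' * X f"
    if f[measurable]: "f \<in> borel_measurable lebesgue" and f0: "\<And>x. 0 \<le> f x"
      and g[measurable]: "g \<in> borel_measurable lebesgue"
      and hyp: "\<And>w. w \<in> Ap_class p\<^sub>0 \<Longrightarrow>
        weak_Lp_norm p\<^sub>0 w g \<le> ennreal (\<phi> (enn2real (Ap_const p\<^sub>0 w))) * Lp_norm p\<^sub>0 w f"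
    for f g :: "real^'n \<Rightarrow> real"
  proof (cases "X f")
    case top
    then show ?thesis using C' by (simp add: ennreal_mult_top)
  next
    case (real A)
    show ?thesis
    proof (cases "A = 0")
      case True
      then have "AE x in lebesgue. f x = 0" using real quasi_banach_ri_eq_0_iff[OF X f] by simp
      then have "Minf_norm X (eabs g) = 0"
        using hyp by (intro Minf_norm_eq_0[OF \<mu> p0 _ g, of f]) auto
      then show ?thesis by simp
    next
      case False
      then have A: "0 < A" "X f \<le> ennreal A" using real by auto
      have nz: "\<not> (AE x in lebesgue. f x = 0)"
        using quasi_banach_ri_eq_0_iff[OF X f] real False by (auto simp: ennreal_eq_0_iff)
      define Z where "Z = maximal_pow \<delta> f"
      have Zm[measurable]: "Z \<in> borel_measurable lebesgue" by (simp add: Z_def)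
      have MZ: "Minf_norm X Z \<le> ennreal (L * A)"
      proof -
        have "Minf_norm X Z \<le> ennreal C\<^sub>M * ennreal A" using M[OF f] real by (simp add: Z_def)
        also have "\<dots> \<le> ennreal L * ennreal A"
          using L(1) by (intro mult_right_mono ennreal_leI) auto
        also have "\<dots> = ennreal (L * A)" using L0 A by (simp add: ennreal_mult)
        finally show ?thesis .
      qed
      \<comment> \<open>Besides its role for the part \<open>H\<close> below, (ii) supplies the
        almost everywhere finiteness that makes \<open>u2\<close> an A_1 weight.\<close>
      have Zfin: "AE x in lebesgue. Z x < \<infinity>"
        by (rule AE_finite_Minf[OF X Zm le_less_trans[OF MZ]]) simp
      define u2 where "u2 x = enn2real (Z x)" for x
      have u2: "A1_weight C2 u2"
        using A1_2[OF f nz] Zfin by (simp add: u2_def[abs_def] Z_def)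
      have fu2: "AE x in lebesgue. f x \<le> u2 x"
        using AE_le_maximal_pow[OF f \<delta>(1)] Zfin
      proof eventually_elim
        case (elim x)
        then obtain z where "0 \<le> z" "Z x = ennreal z" by (cases "Z x") auto
        then show ?case using elim f0[of x] by (simp add: u2_def Z_def[symmetric] ennreal_le_iff)
      qed
      have bounded: "ennreal y * fundamental X s \<le> ennreal C' * X f"
        if s: "0 < s" and y: "0 < y" "ennreal y < rearr lebesgue (eabs g) s" for s y
      proof -
        have "ennreal s < distr_fun lebesgue (eabs g) (ennreal y)"
          using y(2) by (subst (asm) less_rearr_iff) measurable
        then have sy: "ennreal s < emeasure lebesgue {x. y < \<bar>g x\<bar>}"
          using y(1) by (simp add: distr_fun_ennreal)
        have [measurable]: "{x. y < \<bar>g x\<bar>} \<in> sets lebesgue" by (intro lebesgue_Collect) measurable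
        obtain n :: nat where n: "ennreal s < emeasure lebesgue ({x. y < \<bar>g x\<bar>} \<inter> cball 0 (real n))"
          by (rule emeasure_cball_Int_gt[OF _ sy]) measurable
        define G where "G = {x. y < \<bar>g x\<bar>} \<inter> cball 0 (real n)"
        have Gm[measurable]: "G \<in> sets lebesgue" unfolding G_def by (intro sets.Int) auto
        define H where "H = {x. ennreal y < Z x}"
        have Hm[measurable]: "H \<in> sets lebesgue" unfolding H_def by (intro lebesgue_Collect) measurable
        define F where "F = G - H"
        have Fm[measurable]: "F \<in> sets lebesgue" by (simp add: F_def)
        have "ennreal y * fundamental X (s / 2) \<le> ennreal (L * A)"
        \<comment> \<open>\<open>G\<close> has measure above \<open>s\<close> and is covered by
          \<open>H\<close> and \<open>F\<close>. Either \<open>H\<close> exceeds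
          \<open>s / 2\<close> and (ii) applies, or \<open>F\<close> does and the weighted estimate
          applies.\<close>
        proof (cases "ennreal (s / 2) < emeasure lebesgue H")
          case True
          then have "ennreal (s / 2) < distr_fun lebesgue Z (ennreal y)" by (simp add: distr_fun_def H_def)
          then have "ennreal y < rearr lebesgue Z (s / 2)" by (subst less_rearr_iff[OF Zm])
          then have "fundamental X (s / 2) * ennreal y \<le> fundamental X (s / 2) * rearr lebesgue Z (s / 2)"
            by (intro mult_left_mono) auto
          also have "\<dots> \<le> Minf_norm X Z"
            unfolding Minf_norm_def using s by (intro SUP_upper) auto
          finally show ?thesis using MZ by (simp add: mult.commute)
        next
          case False
          have "emeasure lebesgue F \<le> emeasure lebesgue (cball (0::real^'n) (real n))"
            by (intro emeasure_mono) (auto simp: F_def G_def)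
          also have "\<dots> < \<infinity>" using emeasure_lborel_cball_finite[of "0::real^'n" "real n"] by simp
          finally obtain t where t: "0 \<le> t" "emeasure lebesgue F = ennreal t"
            by (cases "emeasure lebesgue F") auto
          have "ennreal s < emeasure lebesgue G" using n by (simp only: G_def)
          also have "\<dots> \<le> emeasure lebesgue (H \<union> F)" by (intro emeasure_mono) (auto simp: F_def)
          also have "\<dots> \<le> emeasure lebesgue H + emeasure lebesgue F" by (intro emeasure_subadditive) auto
          also have "\<dots> \<le> ennreal (s / 2) + ennreal t" using False t by (intro add_mono) auto
          also have "\<dots> = ennreal (s / 2 + t)" using s t by simp
          finally have st: "s / 2 < t" using s by (simp add: ennreal_less_iff)
          then have t0: "0 < t" using s by simp
          obtain h where h: "h \<in> borel_measurable lebesgue"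
            "distr_fun lebesgue (eabs h) = distr_fun (lebesgue_on {0<..}) (\<lambda>r. ennreal (decay t \<mu> r))"
            "associate X h \<le> ennreal D * (ennreal t / fundamental X t)"
            using model[OF t0] by blast
          have u1: "A1_weight C1 (\<lambda>x. enn2real (maximal (indicat_real F) x epowr \<mu>))"
          proof (rule A1_1)
            show "AE x in lebesgue. maximal (indicat_real F) x < \<infinity>"
              by (intro AE_I2 maximal_indicator_finite)
            show "\<not> (AE x in lebesgue. indicat_real F x = 0)"
              by (rule indicator_not_AE_0[OF Fm]) (use t t0 in simp)
          qed measurable
          have Fsub: "F \<subseteq> {x. y < \<bar>g x\<bar> \<and> u2 x \<le> y}"
          proof
            fix x assume x: "x \<in> F"
            then have "Z x \<le> ennreal y" by (simp add: F_def H_def not_less)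
            then have "u2 x \<le> y" unfolding u2_def using y(1) by (intro enn2real_leI) auto
            then show "x \<in> {x. y < \<bar>g x\<bar> \<and> u2 x \<le> y}" using x by (simp add: F_def G_def)
          qed
          have hyp': "weak_Lp_norm p\<^sub>0 w g \<le> ennreal B * Lp_norm p\<^sub>0 w f"
            if w: "w \<in> Ap_class p\<^sub>0" "Ap_const p\<^sub>0 w \<le> ennreal (C1 * C2 powr (p\<^sub>0 - 1))" for w
          proof -
            have "enn2real (Ap_const p\<^sub>0 w) \<le> N" using w(2) N by (intro enn2real_leI) (auto simp: N_def)
            then have "\<phi> (enn2real (Ap_const p\<^sub>0 w)) \<le> B" by (intro \<phi>_le) auto
            then show ?thesis using hyp[OF w(1)] by (meson ennreal_leI mult_right_mono order_trans zero_le)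
          qed
          \<comment> \<open>The weighted estimate is available at the actual measure
            \<open>t\<close> of \<open>F\<close>, which is larger than \<open>s / 2\<close>.\<close>
          have "ennreal y * fundamental X (s / 2) \<le> ennreal y * fundamental X t"
            using s st by (intro mult_left_mono fundamental_mono[OF X]) auto
          also have "\<dots> \<le> ennreal (B powr p\<^sub>0 * (((10 * real CARD('n)) ^ CARD('n) + 1) powr \<mu> * A * D))"
            by (rule level_estimate[OF X p0 \<mu>(1) D h C1 C2 u1 u2 f f0 fu2 A B hyp' g y(1) Fm Fsub t(2) t0])
          also have "\<dots> = ennreal (B powr p\<^sub>0 * (((10 * real CARD('n)) ^ CARD('n) + 1) powr \<mu> * D) * A)"
            by (simp add: mult_ac)
          also have "\<dots> \<le> ennreal (L * A)" using L(2) A by (intro ennreal_leI mult_right_mono) auto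
          finally show ?thesis .
        qed
        note half = this
        have "ennreal y * fundamental X s
            \<le> ennreal y * (ennreal K * (fundamental X (s / 2) + fundamental X (s / 2)))"
          by (intro mult_left_mono fundamental_doubling[OF X s K]) simp
        also have "\<dots> = ennreal K * (ennreal y * fundamental X (s / 2) + ennreal y * fundamental X (s / 2))"
          by (simp add: algebra_simps)
        also have "\<dots> \<le> ennreal (max 0 K) * (ennreal (L * A) + ennreal (L * A))"
          using half by (intro mult_mono add_mono ennreal_leI) auto
        also have "\<dots> = ennreal (max 0 K * (2 * L) * A)"
        proof -
          have "ennreal (L * A) + ennreal (L * A) = ennreal (2 * L * A)"
            using L0 A by (simp flip: ennreal_plus)
          also have "ennreal (max 0 K) * \<dots> = ennreal (max 0 K * (2 * L * A))"
            using L0 A by (intro ennreal_mult[symmetric]) auto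
          finally show ?thesis by (simp only: mult.assoc)
        qed
        also have "\<dots> \<le> ennreal (C' * A)"
          using A by (intro ennreal_leI mult_right_mono) (auto simp: C'_def)
        also have "\<dots> = ennreal C' * X f" using C' A real by (simp add: ennreal_mult)
        finally show ?thesis .
      qed
      show ?thesis
        unfolding Minf_norm_def
      proof (rule SUP_least)
        fix s :: real assume "s \<in> {0<..}"
        then have s: "0 < s" by simp
        obtain c where c: "0 < c" "fundamental X s = ennreal c" by (rule fundamental_pos_finite[OF X s])
        have C'A: "ennreal C' * X f = ennreal (C' * A)" using C' A real by (simp add: ennreal_mult)
        \<comment> \<open>The rearrangement is recovered from the heights below it: a rational
          height between the bound and a larger value would contradict
          \<open>bounded\<close>.\<close>
        have "rearr lebesgue (eabs g) s \<le> ennreal (C' * A / c)"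
        proof (rule ccontr)
          assume "\<not> rearr lebesgue (eabs g) s \<le> ennreal (C' * A / c)"
          then obtain r :: rat where r: "ennreal (C' * A / c) < ennreal (real_of_rat r)"
            "ennreal (real_of_rat r) < rearr lebesgue (eabs g) s"
            using ennreal_rat_dense by (metis not_le)
          have CA: "0 < C' * A / c" using C' A c by simp
          then have r': "C' * A / c < real_of_rat r" using r(1) by (subst (asm) ennreal_less_iff) auto
          then have "ennreal (real_of_rat r) * ennreal c \<le> ennreal (C' * A)"
            using bounded[OF s less_trans[OF CA r'] r(2)] c C'A by simp
          then have "ennreal (real_of_rat r * c) \<le> ennreal (C' * A)"
            using ennreal_mult[OF less_imp_le[OF less_trans[OF CA r']] less_imp_le[OF c(1)]] by (simp only:)
          then have "real_of_rat r * c \<le> C' * A" using C' A by (simp add: ennreal_le_iff)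
          then show False using r' c by (simp add: field_simps)
        qed
        then have "fundamental X s * rearr lebesgue (eabs g) s \<le> ennreal c * ennreal (C' * A / c)"
          unfolding c(2) by (rule mult_left_mono) simp
        also have "\<dots> = ennreal (c * (C' * A / c))" using C' A c by (intro ennreal_mult[symmetric]) auto
        also have "c * (C' * A / c) = C' * A" using c by simp
        finally show "fundamental X s * rearr lebesgue (eabs g) s \<le> ennreal C' * X f" using C'A by simp
      qed
    qed
  qed
  with C' show ?thesis by blast
qed

end
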